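(* Let an $N$-player linear-quadratic generalized Nash game with shared affine constraints be given as in the context, with monotone pseudogradient $\phi(x)=Fx+f$, and let $F_s=\tfrac12(F+F^\top)$. Consider the quadratic program in $(x,\lambda,\nu)\in\mathbb{R}^n\times\mathbb{R}^m\times\mathbb{R}^q$ $$ \begin{aligned} \min_{x,\lambda,\nu}\quad & x^\top F_s x+f^\top x+b^\top\lambda+e^\top\nu\\ \text{s.t.}\quad & Fx+f+A^\top\lambda+E^\top\nu=0,\\ & Ex=e,\quad Ax\le b,\quad \lambda\ge 0. \end{aligned} $$ (i) If this quadratic program is infeasible, then the game admits no v-GNE. (ii) If this quadratic program is feasible, then its optimal value is finite, nonnegative, and attained at some $(x^\star,\lambda^\star,\nu^\star)$; moreover, $x^\star$ is a v-GNE of the game if and only if this optimal value is zero.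
   Context: Game. There are $N$ players; player $i\in\{1,\dots,N\}$ chooses $x_i\in\mathbb{R}^{n_i}$, and $x=(x_1,\dots,x_N)\in\mathbb{R}^n$, $n=\sum_i n_i$; $x_{-i}$ denotes all components of $x$ other than $x_i$. Player $i$ minimizes over $x_i$ the cost $J_i(x)=\tfrac12 x^\top Q^{(i)}x+(c^{(i)})^\top x$, with $Q^{(i)}\in\mathbb{R}^{n\times n}$ symmetric and $c^{(i)}\in\mathbb{R}^n$, subject to the shared constraint $x\in\mathcal{X}=\{x\in\mathbb{R}^n: Ax\le b,\ Ex=e\}$, where $A\in\mathbb{R}^{m\times n}$, $b\in\mathbb{R}^m$, $E\in\mathbb{R}^{q\times n}$, $e\in\mathbb{R}^q$, $m,q\ge 0$. Vector inequalities are componentwise. Pseudogradient. $\phi(x)=Fx+f$, obtained by stacking $\nabla_{x_i}J_i(x)$, i.e. the $i$-th block of rows of $F\in\mathbb{R}^{n\times n}$ (the $n_i$ rows indexed by the coordinates of $x_i$) equals the $i$-th block of rows of $Q^{(i)}$, and the $i$-th block of $f\in\mathbb{R}^n$ equals the $i$-th block of $c^{(i)}$. Standing assumption. $\phi$ is monotone: $(\phi(x)-\phi(y))^\top(x-y)\ge 0$ for all $x,y\in\mathbb{R}^n$ (equivalently $F_s\succeq 0$). v-GNE. A variational generalized Nash equilibrium (v-GNE) is a point $x^\star\in\mathcal{X}$ with $\phi(x^\star)^\top(y-x^\star)\ge 0$ for all $y\in\mathcal{X}$. *)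

theory Defs
  imports
    Complex_Main
    "HOL-Library.Extended_Real"
    "Jordan_Normal_Form.Matrix"
begin

text \<open>
  Players are numbered \<open>0, \<dots>, N - 1\<close> and \<open>ns i\<close> is the dimension of the decision of player \<open>i\<close>.
  A joint decision is a vector of dimension \<open>ns 0 + \<dots> + ns (N - 1)\<close>, the concatenation of the
  individual decisions; vectors and matrices carry their dimensions as values, so the numbers of
  inequality and equality constraints may be zero.
\<close>

definition joint_dim :: "nat \<Rightarrow> (nat \<Rightarrow> nat) \<Rightarrow> nat" where
  "joint_dim N ns = (\<Sum>i<N. ns i)"

definition block :: "(nat \<Rightarrow> nat) \<Rightarrow> nat \<Rightarrow> nat set" where
  "block ns i = {(\<Sum>j<i. ns j) ..< (\<Sum>j<i. ns j) + ns i}"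

text \<open>
  The blocks of the players \<open>i < N\<close> partition the coordinates below \<open>joint_dim N ns\<close>
  (see \<open>owner_less\<close>, \<open>owner_block\<close> and \<open>owner_eqI\<close> below), so the description is definite there.
\<close>

definition owner :: "(nat \<Rightarrow> nat) \<Rightarrow> nat \<Rightarrow> nat" where
  "owner ns k = (THE i. k \<in> block ns i)"

definition cost :: "real mat \<Rightarrow> real vec \<Rightarrow> real vec \<Rightarrow> real" where
  "cost Qi ci x = 1/2 * (x \<bullet> (Qi *\<^sub>v x)) + ci \<bullet> x"

definition pg_mat :: "nat \<Rightarrow> (nat \<Rightarrow> nat) \<Rightarrow> (nat \<Rightarrow> real mat) \<Rightarrow> real mat" where
  "pg_mat N ns Q =
     mat (joint_dim N ns) (joint_dim N ns) (\<lambda>(k, l). Q (owner ns k) $$ (k, l))"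

definition pg_vec :: "nat \<Rightarrow> (nat \<Rightarrow> nat) \<Rightarrow> (nat \<Rightarrow> real vec) \<Rightarrow> real vec" where
  "pg_vec N ns c = vec (joint_dim N ns) (\<lambda>k. c (owner ns k) $ k)"

text \<open>
  This is the stacking of the partial gradients of the costs: see \<open>pseudogradient_partial\<close> below.
\<close>

definition pseudogradient ::
  "nat \<Rightarrow> (nat \<Rightarrow> nat) \<Rightarrow> (nat \<Rightarrow> real mat) \<Rightarrow> (nat \<Rightarrow> real vec) \<Rightarrow> real vec \<Rightarrow> real vec" where
  "pseudogradient N ns Q c x = pg_mat N ns Q *\<^sub>v x + pg_vec N ns c"

definition monotone_map :: "nat \<Rightarrow> (real vec \<Rightarrow> real vec) \<Rightarrow> bool" where
  "monotone_map n \<phi> \<longleftrightarrow>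
     (\<forall>x \<in> carrier_vec n. \<forall>y \<in> carrier_vec n. (\<phi> x - \<phi> y) \<bullet> (x - y) \<ge> 0)"

definition shared_set ::
  "nat \<Rightarrow> real mat \<Rightarrow> real vec \<Rightarrow> real mat \<Rightarrow> real vec \<Rightarrow> real vec set" where
  "shared_set n A b E e = {x \<in> carrier_vec n. A *\<^sub>v x \<le> b \<and> E *\<^sub>v x = e}"

definition is_vGNE :: "(real vec \<Rightarrow> real vec) \<Rightarrow> real vec set \<Rightarrow> real vec \<Rightarrow> bool" where
  "is_vGNE \<phi> X x \<longleftrightarrow> x \<in> X \<and> (\<forall>y \<in> X. \<phi> x \<bullet> (y - x) \<ge> 0)"

definition sym_part :: "real mat \<Rightarrow> real mat" where
  "sym_part F = (1/2) \<cdot>\<^sub>m (F + F\<^sup>T)"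

text \<open>
  The quadratic program in \<open>(x, \<lambda>, \<nu>)\<close>. The numbers of rows of \<open>A\<close> and \<open>E\<close> determine the
  dimensions of \<open>\<lambda>\<close> and \<open>\<nu>\<close>.
\<close>

definition qp_feasible ::
  "real mat \<Rightarrow> real vec \<Rightarrow> real mat \<Rightarrow> real vec \<Rightarrow> real mat \<Rightarrow> real vec
    \<Rightarrow> (real vec \<times> real vec \<times> real vec) set" where
  "qp_feasible F f A b E e =
     {(x, l, v). x \<in> carrier_vec (dim_col F) \<and>
        l \<in> carrier_vec (dim_row A) \<and> v \<in> carrier_vec (dim_row E) \<and>
        F *\<^sub>v x + f + A\<^sup>T *\<^sub>v l + E\<^sup>T *\<^sub>v v = 0\<^sub>v (dim_row F) \<and>
        E *\<^sub>v x = e \<and> A *\<^sub>v x \<le> b \<and> 0\<^sub>v (dim_row A) \<le> l}"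

fun qp_objective ::
  "real mat \<Rightarrow> real vec \<Rightarrow> real vec \<Rightarrow> real vec \<Rightarrow> real vec \<times> real vec \<times> real vec \<Rightarrow> real" where
  "qp_objective F f b e (x, l, v) = x \<bullet> (sym_part F *\<^sub>v x) + f \<bullet> x + b \<bullet> l + e \<bullet> v"

text \<open>
  The infimum is taken in the extended reals: it is \<open>\<infinity>\<close> on an empty set and \<open>-\<infinity>\<close> for an
  unbounded problem, so finiteness of the optimal value is a genuine claim.
\<close>

definition optimal_value :: "'z set \<Rightarrow> ('z \<Rightarrow> real) \<Rightarrow> ereal" where
  "optimal_value S g = (INF z\<in>S. ereal (g z))"

definition is_minimizer :: "'z set \<Rightarrow> ('z \<Rightarrow> real) \<Rightarrow> 'z \<Rightarrow> bool" where
  "is_minimizer S g z \<longleftrightarrow> z \<in> S \<and> ereal (g z) = optimal_value S g"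


lemma owner_eqI:
  assumes "k \<in> block ns i"
  shows "owner ns k = i"
proof -
  have step: "(\<Sum>l<a. ns l) + ns a \<le> (\<Sum>l<b. ns l)" if "a < b" for a b
  proof -
    have "(\<Sum>l<Suc a. ns l) \<le> (\<Sum>l<b. ns l)"
      by (rule sum_mono2) (use that in auto)
    then show ?thesis by simp
  qed
  have "j = i" if "k \<in> block ns j" for j
  proof (rule ccontr)
    assume "j \<noteq> i"
    then consider "j < i" | "i < j" by linarith
    then show False
      using that assms step[of j i] step[of i j] by cases (auto simp: block_def)
  qed
  with assms show ?thesis unfolding owner_def by blast
qed

lemma ex_block: "k < joint_dim N ns \<Longrightarrow> \<exists>i<N. k \<in> block ns i"
proof (induction N)
  case 0
  then show ?case by (simp add: joint_dim_def)
next
  case (Suc N)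
  show ?case
  proof (cases "k < joint_dim N ns")
    case True
    with Suc.IH show ?thesis by (meson less_Suc_eq)
  next
    case False
    with Suc.prems have "k \<in> block ns N" by (auto simp: joint_dim_def block_def)
    then show ?thesis by blast
  qed
qed

lemma owner_less: "k < joint_dim N ns \<Longrightarrow> owner ns k < N"
  using ex_block owner_eqI by blast

lemma owner_block: "k < joint_dim N ns \<Longrightarrow> k \<in> block ns (owner ns k)"
  using ex_block owner_eqI by blast

lemma block_less_joint_dim:
  assumes "i < N" "k \<in> block ns i"
  shows "k < joint_dim N ns"
proof -
  have "(\<Sum>l<Suc i. ns l) \<le> (\<Sum>l<N. ns l)"
    by (rule sum_mono2) (use assms(1) in auto)
  with assms(2) show ?thesis by (simp add: block_def joint_dim_def)
qed

lemma pseudogradient_partial: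
  assumes i: "i < N" and k: "k \<in> block ns i"
    and Q: "Q i \<in> carrier_mat (joint_dim N ns) (joint_dim N ns)" and sym: "(Q i)\<^sup>T = Q i"
    and c: "c i \<in> carrier_vec (joint_dim N ns)" and x: "x \<in> carrier_vec (joint_dim N ns)"
  shows "((\<lambda>t. cost (Q i) (c i) (x + t \<cdot>\<^sub>v unit_vec (joint_dim N ns) k))
           has_real_derivative pseudogradient N ns Q c x $ k) (at 0)"
proof -
  define n where "n = joint_dim N ns"
  define u :: "real vec" where "u = unit_vec n k"
  have kn: "k < n" using block_less_joint_dim[OF i k] by (simp add: n_def)
  have Qn: "Q i \<in> carrier_mat n n" and cn: "c i \<in> carrier_vec n" and xn: "x \<in> carrier_vec n"
    using Q c x by (simp_all add: n_def)
  have un: "u \<in> carrier_vec n" by (simp add: u_def)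
  have Qx: "Q i *\<^sub>v x \<in> carrier_vec n" and Qu: "Q i *\<^sub>v u \<in> carrier_vec n"
    using Qn xn un by auto
  have ow: "owner ns k = i" using owner_eqI[OF k] .
  have "row (pg_mat N ns Q) k = row (Q i) k"
    using kn Qn ow by (intro eq_vecI) (auto simp: pg_mat_def n_def)
  then have D: "pseudogradient N ns Q c x $ k = (Q i *\<^sub>v x) $ k + c i $ k"
    using kn Qn xn ow
    by (simp add: pseudogradient_def pg_vec_def pg_mat_def n_def)
  have xu: "x \<bullet> (Q i *\<^sub>v u) = (Q i *\<^sub>v x) $ k"
  proof -
    have "x \<bullet> (Q i *\<^sub>v u) = (Q i *\<^sub>v u) \<bullet> x" using xn Qu by (rule comm_scalar_prod)
    also have "\<dots> = u \<bullet> ((Q i)\<^sup>T *\<^sub>v x)"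
      using Qn un xn by (metis sym transpose_vec_mult_scalar comm_scalar_prod Qx)
    also have "\<dots> = (Q i *\<^sub>v x) $ k" using sym kn Qx by (simp add: u_def)
    finally show ?thesis .
  qed
  have ux: "u \<bullet> (Q i *\<^sub>v x) = (Q i *\<^sub>v x) $ k" using kn Qx by (simp add: u_def)
  have cu: "c i \<bullet> u = c i $ k" using kn cn by (simp add: u_def)
  have eq: "cost (Q i) (c i) (x + t \<cdot>\<^sub>v u) =
      cost (Q i) (c i) x + t * ((Q i *\<^sub>v x) $ k + c i $ k) + t^2 * (1/2 * (u \<bullet> (Q i *\<^sub>v u)))" for t
  proof -
    have tu: "t \<cdot>\<^sub>v u \<in> carrier_vec n" using un by simp
    have 1: "Q i *\<^sub>v (x + t \<cdot>\<^sub>v u) = Q i *\<^sub>v x + t \<cdot>\<^sub>v (Q i *\<^sub>v u)"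
      using mult_add_distrib_mat_vec[OF Qn xn tu] mult_mat_vec[OF Qn un] by simp
    have tQu: "t \<cdot>\<^sub>v (Q i *\<^sub>v u) \<in> carrier_vec n" using Qu by simp
    show ?thesis
      unfolding cost_def 1
      using xn un tu Qx Qu tQu cn xu ux cu
      by (simp add: add_scalar_prod_distrib[of _ n] scalar_prod_add_distrib[of _ n]
          algebra_simps power2_eq_square)
  qed
  have "((\<lambda>t. cost (Q i) (c i) x + t * ((Q i *\<^sub>v x) $ k + c i $ k)
          + t^2 * (1/2 * (u \<bullet> (Q i *\<^sub>v u))))
        has_real_derivative ((Q i *\<^sub>v x) $ k + c i $ k)) (at 0)"
    by (auto intro!: derivative_eq_intros)
  then show ?thesis using D eq by (simp add: u_def n_def)
qed

end

theory Submission
  imports Defs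
begin

text \<open>
  Multiplying the equality constraint of the quadratic program by \<open>x\<close> turns its objective into the
  complementarity gap \<open>(b - A x) \<bullet> l \<ge> 0\<close>. Hence a feasible point of value zero satisfies the KKT
  conditions of the variational inequality, and a v-GNE together with its multipliers is a feasible
  point of value zero. Attainment is the Frank--Wolfe theorem for a convex quadratic bounded below
  on a polyhedron: the minimizers of the objective plus \<open>\<epsilon> |z|\<^sup>2\<close> stay bounded as \<open>\<epsilon> \<rightarrow> 0\<close>. The same
  theorem, applied to a penalized least squares problem for \<open>(l, v)\<close>, produces the multipliers and
  thereby replaces Farkas' lemma.
\<close>

section \<open>Limits of vector sequences\<close>

text \<open>The obstacle to attainment is that the objective is linear in (l, v) and its quadratic
  part in x may be degenerate, so sublevel sets can be unbounded. Monotonicity enters by making F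
  positive semidefinite, that is, by making the program convex. The penalized least squares problem
  has a geometric origin. With g the value of the pseudogradient at x, it is, up to sign, scale and
  a constant, the Lagrangian dual of projecting x - g onto X, and x - r is that projection. A point
  x of X solves the variational inequality exactly when it equals the projection of x - g, which is
  why the residual r must vanish. The rows of A and E may be dependent, so this dual problem can be
  degenerate as well, and its minimum is again supplied by the Frank--Wolfe argument.\<close>

definition vec_limit :: "nat \<Rightarrow> (nat \<Rightarrow> real vec) \<Rightarrow> real vec \<Rightarrow> bool" where
  "vec_limit d w z \<longleftrightarrow> (\<forall>j. w j \<in> carrier_vec d) \<and> z \<in> carrier_vec d \<and>
     (\<forall>i<d. (\<lambda>j. w j $ i) \<longlonglongrightarrow> z $ i)"

lemma vec_limit_const: "z \<in> carrier_vec d \<Longrightarrow> vec_limit d (\<lambda>_. z) z"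
  by (simp add: vec_limit_def)

lemma vec_limit_scalar_prod:
  assumes "vec_limit d v x" "vec_limit d w y"
  shows "(\<lambda>j. v j \<bullet> w j) \<longlonglongrightarrow> x \<bullet> y"
proof -
  have dims: "dim_vec (w j) = d" "dim_vec y = d" for j
    using assms(2) by (auto simp: vec_limit_def)
  show ?thesis
    unfolding scalar_prod_def dims
    by (intro tendsto_sum tendsto_mult) (use assms in \<open>auto simp: vec_limit_def\<close>)
qed

lemma vec_limit_mult_mat_vec:
  assumes "A \<in> carrier_mat m d" "vec_limit d w z"
  shows "vec_limit m (\<lambda>j. A *\<^sub>v w j) (A *\<^sub>v z)"
proof -
  have "(\<lambda>j. (A *\<^sub>v w j) $ i) \<longlonglongrightarrow> (A *\<^sub>v z) $ i" if "i < m" for i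
  proof -
    have "row A i \<in> carrier_vec d" using assms(1) that by auto
    from vec_limit_scalar_prod[OF vec_limit_const[OF this] assms(2)] show ?thesis
      using assms(1) that by simp
  qed
  with assms show ?thesis by (auto simp: vec_limit_def)
qed

lemma vec_limit_unique:
  assumes "vec_limit d w x" "vec_limit d w y"
  shows "x = y"
proof (rule eq_vecI)
  fix i assume "i < dim_vec y"
  with assms have "(\<lambda>j. w j $ i) \<longlonglongrightarrow> x $ i" "(\<lambda>j. w j $ i) \<longlonglongrightarrow> y $ i"
    by (auto simp: vec_limit_def)
  then show "x $ i = y $ i" by (rule LIMSEQ_unique)
qed (use assms in \<open>auto simp: vec_limit_def\<close>)

lemma vec_limit_le:
  assumes "vec_limit d w z" "y \<in> carrier_vec d" "\<And>j. w j \<le> y"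
  shows "z \<le> y"
  using assms
  by (auto simp: vec_limit_def less_eq_vec_def intro!: LIMSEQ_le_const2)

text \<open>Bolzano--Weierstrass by induction on the number of coordinates handled: a further
  monotone subsequence makes the next coordinate converge and keeps the convergence of the earlier
  ones.\<close>

lemma bounded_vec_seq_limit:
  fixes w :: "nat \<Rightarrow> real vec"
  assumes w: "\<And>j. w j \<in> carrier_vec d" and B: "\<And>i j. i < d \<Longrightarrow> \<bar>w j $ i\<bar> \<le> B"
  obtains r z where "strict_mono r" "vec_limit d (w \<circ> r) z"
proof -
  have "\<exists>r. strict_mono r \<and> (\<forall>i<k. convergent (\<lambda>j. w (r j) $ i))" if "k \<le> d" for k
    using that
  proof (induction k)
    case 0
    then show ?case by (auto intro: exI[of _ id] strict_mono_id)
  next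
    case (Suc k)
    then obtain r where r: "strict_mono r" "\<And>i. i < k \<Longrightarrow> convergent (\<lambda>j. w (r j) $ i)"
      by auto
    obtain s where s: "strict_mono s" "monoseq (\<lambda>j. w (r (s j)) $ k)"
      using seq_monosub[of "\<lambda>j. w (r j) $ k"] by auto
    have "Bseq (\<lambda>j. w (r (s j)) $ k)"
      using B Suc.prems by (intro BseqI'[of _ B]) auto
    then have "convergent (\<lambda>j. w (r (s j)) $ k)" using s(2) by (rule Bseq_monoseq_convergent)
    moreover have "convergent (\<lambda>j. w (r (s j)) $ i)" if "i < k" for i
      using convergent_subseq_convergent[OF r(2)[OF that] s(1)] by (simp add: o_def)
    ultimately have "\<forall>i<Suc k. convergent (\<lambda>j. w ((r \<circ> s) j) $ i)"
      by (auto simp: less_Suc_eq)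
    then show ?case using strict_mono_o[OF r(1) s(1)] by blast
  qed
  then obtain r where r: "strict_mono r" "\<And>i. i < d \<Longrightarrow> convergent (\<lambda>j. w (r j) $ i)" by auto
  have "vec_limit d (w \<circ> r) (vec d (\<lambda>i. lim (\<lambda>j. w (r j) $ i)))"
    using w r(2) by (auto simp: vec_limit_def convergent_LIMSEQ_iff)
  with r(1) that show ?thesis by blast
qed

lemma coord_le_sqrt_scalar_prod:
  fixes z :: "real vec"
  assumes "z \<in> carrier_vec d" "i < d"
  shows "\<bar>z $ i\<bar> \<le> sqrt (z \<bullet> z)"
proof -
  have "(z $ i)^2 \<le> (\<Sum>j\<in>{0..<dim_vec z}. z $ j * z $ j)"
    unfolding power2_eq_square by (rule member_le_sum) (use assms in auto)
  then show ?thesis by (intro real_le_rsqrt) (simp add: scalar_prod_def)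
qed

lemma scalar_prod_self_nonneg: "0 \<le> z \<bullet> (z :: real vec)"
  by (auto simp: scalar_prod_def intro: sum_nonneg)

lemma scalar_prod_self_eq_0:
  assumes "z \<in> carrier_vec d" "z \<bullet> (z :: real vec) \<le> 0"
  shows "z = 0\<^sub>v d"
  using coord_le_sqrt_scalar_prod[OF assms(1)] scalar_prod_self_nonneg[of z] assms
  by (intro eq_vecI) force+

text \<open>Weierstrass's theorem by a minimizing sequence. Closedness and continuity are
  sequential, in terms of \<open>vec_limit\<close>; the lower bound \<open>L\<close> makes
  \<open>Inf\<close> a genuine infimum.\<close>

lemma attains_min:
  fixes C :: "real vec set" and p :: "real vec \<Rightarrow> real"
  assumes C: "C \<subseteq> carrier_vec d" "C \<noteq> {}"
    and bdd: "\<And>z. z \<in> C \<Longrightarrow> z \<bullet> z \<le> R"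
    and closed: "\<And>w z. vec_limit d w z \<Longrightarrow> (\<And>j. w j \<in> C) \<Longrightarrow> z \<in> C"
    and cont: "\<And>w z. vec_limit d w z \<Longrightarrow> (\<lambda>j. p (w j)) \<longlonglongrightarrow> p z"
    and below: "\<And>z. z \<in> C \<Longrightarrow> L \<le> p z"
  obtains z where "z \<in> C" "\<And>y. y \<in> C \<Longrightarrow> p z \<le> p y"
proof -
  define I where "I = Inf (p ` C)"
  have bb: "bdd_below (p ` C)" using below by (rule bdd_belowI2)
  have "\<exists>z\<in>C. p z < I + 1 / Suc j" for j
    using cInf_lessD[of "p ` C" "I + 1 / Suc j"] C(2) by (auto simp: I_def)
  then obtain w where w: "\<And>j. w j \<in> C" "\<And>j. p (w j) < I + 1 / Suc j" by metis
  have "\<bar>w j $ i\<bar> \<le> sqrt R" if "i < d" for i j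
    using coord_le_sqrt_scalar_prod[of "w j" d i] bdd[OF w(1)[of j]] w(1)[of j] C(1) that
    by (meson order_trans real_sqrt_le_mono subsetD)
  then obtain r z where r: "strict_mono r" and z: "vec_limit d (w \<circ> r) z"
    using bounded_vec_seq_limit[of w d "sqrt R"] w(1) C(1) by blast
  have "(\<lambda>j. I + 1 / Suc (r j)) \<longlonglongrightarrow> I + 0"
    by (intro tendsto_add tendsto_const)
      (use LIMSEQ_subseq_LIMSEQ[OF LIMSEQ_inverse_real_of_nat r]
        in \<open>simp add: o_def inverse_eq_divide\<close>)
  then have "p z \<le> I + 0"
    by (rule LIMSEQ_le[OF cont[OF z]]) (use w(2) in \<open>auto intro: less_imp_le\<close>)
  moreover have "z \<in> C" using closed[OF z] w(1) by simp
  moreover have "I \<le> p y" if "y \<in> C" for y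
    unfolding I_def using bb that by (auto intro: cInf_lower)
  ultimately show ?thesis using that[of z] by (metis add.right_neutral order_trans)
qed

section \<open>Attainment for convex quadratic programs\<close>

definition polyhedron ::
  "nat \<Rightarrow> real mat \<Rightarrow> real vec \<Rightarrow> real mat \<Rightarrow> real vec \<Rightarrow> real vec set" where
  "polyhedron d G h K k = {z \<in> carrier_vec d. G *\<^sub>v z \<le> h \<and> K *\<^sub>v z = k}"

text \<open>The quadratic term has no factor 1/2, like the objective of the program, so for general
  \<open>H\<close> the slope in direction w is the sum of both cross terms plus g \<bullet>
  w.\<close>

definition quad :: "real mat \<Rightarrow> real vec \<Rightarrow> real vec \<Rightarrow> real" where
  "quad H g z = z \<bullet> (H *\<^sub>v z) + g \<bullet> z"

lemma quad_add_smult: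
  assumes H: "H \<in> carrier_mat d d" and g: "g \<in> carrier_vec d"
    and z: "z \<in> carrier_vec d" and w: "w \<in> carrier_vec d"
  shows "quad H g (z + t \<cdot>\<^sub>v w) =
    quad H g z + t * (z \<bullet> (H *\<^sub>v w) + w \<bullet> (H *\<^sub>v z) + g \<bullet> w) + t^2 * (w \<bullet> (H *\<^sub>v w))"
proof -
  have c: "H *\<^sub>v z \<in> carrier_vec d" "H *\<^sub>v w \<in> carrier_vec d" "t \<cdot>\<^sub>v w \<in> carrier_vec d"
    "t \<cdot>\<^sub>v (H *\<^sub>v w) \<in> carrier_vec d"
    using assms by auto
  have "H *\<^sub>v (z + t \<cdot>\<^sub>v w) = H *\<^sub>v z + t \<cdot>\<^sub>v (H *\<^sub>v w)"
    using mult_add_distrib_mat_vec[OF H z c(3)] mult_mat_vec[OF H w] by simp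
  then show ?thesis
    unfolding quad_def using assms c
    by (simp add: add_scalar_prod_distrib[of _ d] scalar_prod_add_distrib[of _ d]
        algebra_simps power2_eq_square)
qed

lemma scalar_prod_self_add_smult:
  fixes z w :: "real vec"
  assumes z: "z \<in> carrier_vec d" and w: "w \<in> carrier_vec d"
  shows "(z + t \<cdot>\<^sub>v w) \<bullet> (z + t \<cdot>\<^sub>v w) = z \<bullet> z + 2 * t * (z \<bullet> w) + t^2 * (w \<bullet> w)"
proof -
  have c: "t \<cdot>\<^sub>v w \<in> carrier_vec d" using w by simp
  show ?thesis using assms c comm_scalar_prod[OF w z]
    by (simp add: add_scalar_prod_distrib[of _ d] scalar_prod_add_distrib[of _ d]
        algebra_simps power2_eq_square)
qed

lemma polyhedron_closed:
  assumes G: "G \<in> carrier_mat m d" and h: "h \<in> carrier_vec m" and K: "K \<in> carrier_mat p d"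
    and w: "vec_limit d w z" "\<And>j. w j \<in> polyhedron d G h K k"
  shows "z \<in> polyhedron d G h K k"
proof -
  have "G *\<^sub>v z \<le> h"
    using vec_limit_le[OF vec_limit_mult_mat_vec[OF G w(1)] h] w(2)
    by (simp add: polyhedron_def)
  moreover have "K *\<^sub>v z = k"
  proof -
    have 1: "K *\<^sub>v w j = k" for j using w(2) by (simp add: polyhedron_def)
    \<comment> \<open>The dimension of \<open>k\<close> is read off from the equation K w = k at a
      member of the sequence.\<close>
    have "k \<in> carrier_vec p"
      using 1[of 0] K by (metis carrier_matD(1) carrier_vecI dim_mult_mat_vec)
    with 1 vec_limit_unique[OF vec_limit_mult_mat_vec[OF K w(1)]] vec_limit_const
    show ?thesis by simp
  qed
  ultimately show ?thesis using w(1) by (simp add: polyhedron_def vec_limit_def)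
qed

lemma quad_continuous:
  assumes "H \<in> carrier_mat d d" "g \<in> carrier_vec d" "vec_limit d w z"
  shows "(\<lambda>j. quad H g (w j)) \<longlonglongrightarrow> quad H g z"
  unfolding quad_def
  using assms
  by (intro tendsto_add vec_limit_scalar_prod[of d] vec_limit_mult_mat_vec vec_limit_const)

text \<open>Along the line z + t w the form is affine in t, because its t^2 coefficient vanishes. An
  affine function that is nonnegative on the whole line is constant, so its slope, the sum of the
  cross terms, is zero.\<close>

lemma psd_null_cross:
  fixes H :: "real mat"
  assumes H: "H \<in> carrier_mat d d" and psd: "\<And>z. z \<in> carrier_vec d \<Longrightarrow> 0 \<le> z \<bullet> (H *\<^sub>v z)"
    and w: "w \<in> carrier_vec d" "w \<bullet> (H *\<^sub>v w) \<le> 0" and z: "z \<in> carrier_vec d"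
  shows "z \<bullet> (H *\<^sub>v w) + w \<bullet> (H *\<^sub>v z) = 0"
proof (rule ccontr)
  define a where "a = z \<bullet> (H *\<^sub>v w) + w \<bullet> (H *\<^sub>v z)"
  \<comment> \<open>At this t the affine function z \<bullet> (H z) + t a takes the value
    -1.\<close>
  define t where "t = - (z \<bullet> (H *\<^sub>v z) + 1) / a"
  assume "z \<bullet> (H *\<^sub>v w) + w \<bullet> (H *\<^sub>v z) \<noteq> 0"
  then have a: "a \<noteq> 0" by (simp add: a_def)
  have "w \<bullet> (H *\<^sub>v w) = 0" using w psd by force
  moreover have "0 \<le> quad H (0\<^sub>v d) (z + t \<cdot>\<^sub>v w)"
    using psd[of "z + t \<cdot>\<^sub>v w"] w z by (simp add: quad_def)
  ultimately have "0 \<le> z \<bullet> (H *\<^sub>v z) + t * a"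
    using quad_add_smult[OF H zero_carrier_vec z w(1), of t] w z
    by (simp add: quad_def a_def)
  then show False using a by (simp add: t_def)
qed

section \<open>The Frank--Wolfe theorem by regularization\<close>

context
  fixes d m p :: nat and G K H :: "real mat" and h k g :: "real vec" and P :: "real vec set"
  assumes G: "G \<in> carrier_mat m d" and h: "h \<in> carrier_vec m" and K: "K \<in> carrier_mat p d"
    and H: "H \<in> carrier_mat d d" and g: "g \<in> carrier_vec d"
    and psd: "\<And>z. z \<in> carrier_vec d \<Longrightarrow> 0 \<le> z \<bullet> (H *\<^sub>v z)"
  defines "P \<equiv> polyhedron d G h K k"
begin

lemma polyhedron_carrier: "z \<in> P \<Longrightarrow> z \<in> carrier_vec d"
  by (simp add: P_def polyhedron_def)

text \<open>The penalty bounds the sublevel set of z0: where the regularized value is at most that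
  of z0, the bound L leaves at most (p z0 - L) / \<epsilon> for |z|^2.\<close>

lemma regularized_attains_min:
  assumes ne: "z0 \<in> P" and below: "\<And>z. z \<in> P \<Longrightarrow> L \<le> quad H g z" and \<epsilon>: "0 < \<epsilon>"
  obtains z where "z \<in> P" "\<And>y. y \<in> P \<Longrightarrow> quad H g z + \<epsilon> * (z \<bullet> z) \<le> quad H g y + \<epsilon> * (y \<bullet> y)"
proof -
  define p where "p z = quad H g z + \<epsilon> * (z \<bullet> z)" for z
  define C where "C = {z \<in> P. p z \<le> p z0}"
  have cont: "(\<lambda>j. p (w j)) \<longlonglongrightarrow> p z" if "vec_limit d w z" for w z
    unfolding p_def using that H g
    by (intro tendsto_add tendsto_mult tendsto_const quad_continuous vec_limit_scalar_prod) auto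
  obtain z where "z \<in> C" "\<And>y. y \<in> C \<Longrightarrow> p z \<le> p y"
  proof (rule attains_min[of C d "(p z0 - L) / \<epsilon>" p L])
    show "C \<subseteq> carrier_vec d" using polyhedron_carrier by (auto simp: C_def)
    show "C \<noteq> {}" using ne by (auto simp: C_def)
    show "z \<bullet> z \<le> (p z0 - L) / \<epsilon>" if "z \<in> C" for z
      using that below[of z] \<epsilon> by (simp add: C_def p_def field_simps)
    show "L \<le> p z" if "z \<in> C" for z
      using that below[of z] \<epsilon> scalar_prod_self_nonneg[of z]
      by (simp add: C_def p_def add_increasing2)
    show "z \<in> C" if w: "vec_limit d w z" "\<And>j. w j \<in> C" for w z
    proof -
      have "z \<in> P"
        unfolding P_def by (rule polyhedron_closed[OF G h K w(1)]) (use w(2) in \<open>simp add: C_def P_def\<close>)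
      moreover have "p z \<le> p z0"
        using w(2) by (intro LIMSEQ_le_const2[OF cont[OF w(1)]]) (simp add: C_def)
      ultimately show ?thesis by (simp add: C_def)
    qed
  qed (use cont in auto)
  then show ?thesis using that[of z] ne unfolding C_def p_def by (smt (verit) mem_Collect_eq)
qed

text \<open>
  A limit direction of escaping minimizers would be a direction along which the objective is
  constant, so that going back a little along it stays in the polyhedron and decreases the norm.
\<close>

lemma regularized_minimizers_bounded:
  assumes ne: "z0 \<in> P" and below: "\<And>z. z \<in> P \<Longrightarrow> L \<le> quad H g z"
  shows "\<exists>R. \<forall>\<epsilon> z. 0 < \<epsilon> \<longrightarrow> \<epsilon> \<le> 1 \<longrightarrow> z \<in> P \<longrightarrow>
    (\<forall>y\<in>P. quad H g z + \<epsilon> * (z \<bullet> z) \<le> quad H g y + \<epsilon> * (y \<bullet> y)) \<longrightarrow> sqrt (z \<bullet> z) \<le> R"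
proof (rule ccontr)
  assume neg: "\<not> ?thesis"
  \<comment> \<open>Each candidate bound j + 1 is violated by some minimizer w j. The parameters
    \<epsilon> j are only kept in (0, 1]; no limit of them is taken.\<close>
  have "\<exists>\<epsilon> z. 0 < \<epsilon> \<and> \<epsilon> \<le> 1 \<and> z \<in> P \<and>
    (\<forall>y\<in>P. quad H g z + \<epsilon> * (z \<bullet> z) \<le> quad H g y + \<epsilon> * (y \<bullet> y)) \<and> real (Suc j) < sqrt (z \<bullet> z)"
    for j :: nat
    using neg by (meson not_le)
  then obtain \<epsilon> w where \<epsilon>: "\<And>j. 0 < \<epsilon> j" "\<And>j. \<epsilon> j \<le> 1" and w: "\<And>j. w j \<in> P"
    and wmin: "\<And>j y. y \<in> P \<Longrightarrow>
      quad H g (w j) + \<epsilon> j * (w j \<bullet> w j) \<le> quad H g y + \<epsilon> j * (y \<bullet> y)"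
    and big: "\<And>j::nat. real (Suc j) < sqrt (w j \<bullet> w j)" by metis
  define s where "s j = sqrt (w j \<bullet> w j)" for j
  define u where "u j = (1 / s j) \<cdot>\<^sub>v w j" for j
  have spos: "0 < s j" for j using big[of j] unfolding s_def by linarith
  have wc: "w j \<in> carrier_vec d" for j using w polyhedron_carrier by blast
  have uc: "u j \<in> carrier_vec d" for j using wc by (simp add: u_def)
  have wu: "w j = s j \<cdot>\<^sub>v u j" for j
    using spos[of j] by (simp add: u_def smult_smult_assoc)
  have uu: "u j \<bullet> u j = 1" for j
  proof -
    have "w j \<bullet> w j = s j * (s j * (u j \<bullet> u j))" using uc[of j] by (subst (1 2) wu) simp
    moreover have "w j \<bullet> w j = s j * s j"
      unfolding s_def using scalar_prod_self_nonneg by simp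
    ultimately show ?thesis using spos[of j] by simp
  qed
  have "\<bar>u j $ i\<bar> \<le> 1" if "i < d" for i j
    using coord_le_sqrt_scalar_prod[OF uc that, of j] uu by simp
  then obtain r v where r: "strict_mono r" and lim: "vec_limit d (u \<circ> r) v"
    using bounded_vec_seq_limit[of u d 1] uc by blast
  \<comment> \<open>Along the subsequence, W j = \<sigma> j U j, where \<sigma> j tends to infinity
    and U j tends to the unit vector v.\<close>
  define W \<sigma> U where "W j = w (r j)" and "\<sigma> j = s (r j)" and "U j = u (r j)" for j
  have Uv: "vec_limit d U v" using lim by (simp add: U_def[abs_def] o_def)
  have WU: "W j = \<sigma> j \<cdot>\<^sub>v U j" for j using wu by (simp add: W_def \<sigma>_def U_def)
  have Uc: "U j \<in> carrier_vec d" and Wc: "W j \<in> carrier_vec d" and WP: "W j \<in> P" for j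
    using uc wc w by (auto simp: U_def W_def)
  have \<sigma>pos: "0 < \<sigma> j" for j using spos by (simp add: \<sigma>_def)
  have v: "v \<in> carrier_vec d" using Uv by (simp add: vec_limit_def)
  have inv0: "(\<lambda>j. 1 / \<sigma> j) \<longlonglongrightarrow> 0"
  proof (rule tendsto_sandwich[OF _ _ tendsto_const])
    show "\<forall>\<^sub>F j in sequentially. 1 / \<sigma> j \<le> inverse (real (Suc j))"
    proof (rule always_eventually, rule allI)
      fix j
      have "real (Suc j) \<le> real (Suc (r j))" using strict_mono_imp_increasing[OF r, of j] by simp
      then have "real (Suc j) \<le> \<sigma> j" using big[of "r j"] by (simp add: \<sigma>_def s_def)
      then show "1 / \<sigma> j \<le> inverse (real (Suc j))"
        by (simp add: inverse_eq_divide frac_le)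
    qed
    show "\<forall>\<^sub>F j in sequentially. 0 \<le> 1 / \<sigma> j" using \<sigma>pos by (simp add: less_imp_le)
  qed (rule LIMSEQ_inverse_real_of_nat)
  \<comment> \<open>The sequence is the negated slack of row i divided by \<sigma> j. Subtracting h
    $ i / \<sigma> j does not change the limit but fixes the sign: feasibility gives (G v) $ i \<le>
    0, and later a strictly negative limit gives strict slack.\<close>
  have GU: "(\<lambda>j. (G *\<^sub>v U j) $ i - h $ i * (1 / \<sigma> j)) \<longlonglongrightarrow> (G *\<^sub>v v) $ i" if "i < m" for i
  proof -
    have "(\<lambda>j. (G *\<^sub>v U j) $ i - h $ i * (1 / \<sigma> j)) \<longlonglongrightarrow> (G *\<^sub>v v) $ i - h $ i * 0"
      by (intro tendsto_diff tendsto_mult inv0 tendsto_const)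
        (use vec_limit_mult_mat_vec[OF G Uv] that in \<open>simp add: vec_limit_def\<close>)
    then show ?thesis by simp
  qed
  have GW: "(G *\<^sub>v W j) $ i = \<sigma> j * (G *\<^sub>v U j) $ i" if "i < m" for i j
    using mult_mat_vec[OF G Uc, of "\<sigma> j" j] G that WU by simp
  have GWh: "(G *\<^sub>v W j) $ i \<le> h $ i" if "i < m" for i j
    using WP[of j] h that by (auto simp: P_def polyhedron_def less_eq_vec_def)
  have Gv: "(G *\<^sub>v v) $ i \<le> 0" if "i < m" for i
  proof (rule LIMSEQ_le_const2[OF GU[OF that]])
    show "\<exists>N. \<forall>j\<ge>N. (G *\<^sub>v U j) $ i - h $ i * (1 / \<sigma> j) \<le> 0"
      using GW[OF that] GWh[OF that] \<sigma>pos by (simp add: field_simps)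
  qed
  have Kv: "K *\<^sub>v v = 0\<^sub>v p"
  proof (rule eq_vecI)
    fix i assume i: "i < dim_vec (0\<^sub>v p :: real vec)"
    have "(K *\<^sub>v U j) $ i = k $ i * (1 / \<sigma> j)" for j
    proof -
      have "K *\<^sub>v W j = k" using WP[of j] by (simp add: P_def polyhedron_def)
      then have "k $ i = \<sigma> j * (K *\<^sub>v U j) $ i"
        using mult_mat_vec[OF K Uc, of "\<sigma> j" j] K i WU by auto
      then show ?thesis using \<sigma>pos[of j] by simp
    qed
    moreover have "(\<lambda>j. (K *\<^sub>v U j) $ i) \<longlonglongrightarrow> (K *\<^sub>v v) $ i"
      using vec_limit_mult_mat_vec[OF K Uv] i by (simp add: vec_limit_def)
    moreover have "(\<lambda>j. k $ i * (1 / \<sigma> j)) \<longlonglongrightarrow> k $ i * 0"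
      by (intro tendsto_mult inv0 tendsto_const)
    ultimately show "(K *\<^sub>v v) $ i = 0\<^sub>v p $ i" using i LIMSEQ_unique by fastforce
  qed (use K in auto)
  \<comment> \<open>C bounds the objective at every W j: compare with z0 and use \<epsilon> \<le>
    1.\<close>
  define C where "C = \<bar>quad H g z0\<bar> + z0 \<bullet> z0"
  have qW: "quad H g (W j) \<le> C" for j
  proof -
    have "0 \<le> \<epsilon> (r j) * (W j \<bullet> W j)" using \<epsilon>(1)[of "r j"] scalar_prod_self_nonneg[of "W j"] by simp
    moreover have "\<epsilon> (r j) * (z0 \<bullet> z0) \<le> z0 \<bullet> z0"
      using \<epsilon>(2)[of "r j"] scalar_prod_self_nonneg[of z0] by (simp add: mult_left_le_one_le \<epsilon>(1) less_imp_le)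
    ultimately show ?thesis using wmin[OF ne, of "r j"] by (simp add: W_def C_def)
  qed
  have HW: "W j \<bullet> (H *\<^sub>v W j) = \<sigma> j * (\<sigma> j * (U j \<bullet> (H *\<^sub>v U j)))"
    and gW: "g \<bullet> W j = \<sigma> j * (g \<bullet> U j)" for j
    using Uc[of j] g H mult_mat_vec[OF H Uc, of "\<sigma> j" j] unfolding WU by simp_all
  have limg: "(\<lambda>j. g \<bullet> U j) \<longlonglongrightarrow> g \<bullet> v"
    using vec_limit_scalar_prod[OF vec_limit_const[OF g] Uv] .
  have limH: "(\<lambda>j. U j \<bullet> (H *\<^sub>v U j)) \<longlonglongrightarrow> v \<bullet> (H *\<^sub>v v)"
    using vec_limit_scalar_prod[OF Uv vec_limit_mult_mat_vec[OF H Uv]] .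
  \<comment> \<open>Divide \<open>quad H g (W j) \<le> C\<close> by \<sigma> j, dropping the
    nonnegative quadratic part; dividing by \<sigma> j twice gives \<open>vHv\<close>.\<close>
  have gv_le: "g \<bullet> v \<le> 0"
  proof (rule LIMSEQ_le[OF limg])
    show "(\<lambda>j. C * (1 / \<sigma> j)) \<longlonglongrightarrow> 0" using tendsto_mult[OF tendsto_const inv0, of C] by simp
    have "g \<bullet> U j \<le> C * (1 / \<sigma> j)" for j
      using qW[of j] psd[OF Wc, of j] gW[of j] \<sigma>pos[of j] by (simp add: quad_def field_simps)
    then show "\<exists>N. \<forall>j\<ge>N. g \<bullet> U j \<le> C * (1 / \<sigma> j)" by blast
  qed
  have vHv: "v \<bullet> (H *\<^sub>v v) \<le> 0"
  proof (rule LIMSEQ_le[OF limH])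
    have "(\<lambda>j. (C * (1 / \<sigma> j) - g \<bullet> U j) * (1 / \<sigma> j)) \<longlonglongrightarrow> (C * 0 - g \<bullet> v) * 0"
      by (intro tendsto_intros inv0 limg)
    then show "(\<lambda>j. (C * (1 / \<sigma> j) - g \<bullet> U j) * (1 / \<sigma> j)) \<longlonglongrightarrow> 0" by simp
    have "U j \<bullet> (H *\<^sub>v U j) \<le> (C * (1 / \<sigma> j) - g \<bullet> U j) * (1 / \<sigma> j)" for j
      using qW[of j] gW[of j] HW[of j] \<sigma>pos[of j] by (simp add: quad_def field_simps)
    then show "\<exists>N. \<forall>j\<ge>N. U j \<bullet> (H *\<^sub>v U j) \<le> (C * (1 / \<sigma> j) - g \<bullet> U j) * (1 / \<sigma> j)"
      by blast
  qed
  have vHv0: "v \<bullet> (H *\<^sub>v v) = 0" using vHv psd[OF v] by linarith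
  have along: "quad H g (z + t \<cdot>\<^sub>v v) = quad H g z + t * (g \<bullet> v)" if "z \<in> carrier_vec d" for z t
    using quad_add_smult[OF H g that v, of t] psd_null_cross[OF H psd v vHv that] vHv0 by simp
  have Gzt: "(G *\<^sub>v (z + t \<cdot>\<^sub>v v)) $ i = (G *\<^sub>v z) $ i + t * (G *\<^sub>v v) $ i"
    if "z \<in> carrier_vec d" "i < m" for z t i
    using that mult_add_distrib_mat_vec[OF G that(1), of "t \<cdot>\<^sub>v v"] mult_mat_vec[OF G v] v G by simp
  have Kzt: "K *\<^sub>v (z + t \<cdot>\<^sub>v v) = k" if "z \<in> P" for z t
    using that mult_add_distrib_mat_vec[OF K, of z "t \<cdot>\<^sub>v v"] mult_mat_vec[OF K v] v K Kv
    by (auto simp: P_def polyhedron_def)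
  have inP: "z + t \<cdot>\<^sub>v v \<in> P"
    if "z \<in> P" "\<And>i. i < m \<Longrightarrow> (G *\<^sub>v z) $ i + t * (G *\<^sub>v v) $ i \<le> h $ i" for z t
    using that Kzt[OF that(1), of t] Gzt[OF polyhedron_carrier[OF that(1)]] v G h
      polyhedron_carrier[OF that(1)]
    by (simp add: P_def polyhedron_def less_eq_vec_def)
  have gv_ge: "0 \<le> g \<bullet> v"
  proof (rule ccontr)
    assume neg: "\<not> 0 \<le> g \<bullet> v"
    \<comment> \<open>As v is a recession direction, z0 + t v is feasible; this t lowers the
      objective there by |L| + |quad H g z0| + 1, hence below L.\<close>
    define t where "t = (\<bar>L\<bar> + \<bar>quad H g z0\<bar> + 1) / - (g \<bullet> v)"
    have t: "0 \<le> t" "t * (g \<bullet> v) = - (\<bar>L\<bar> + \<bar>quad H g z0\<bar> + 1)"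
      using neg by (auto simp: t_def field_simps)
    have "z0 + t \<cdot>\<^sub>v v \<in> P"
    proof (rule inP[OF ne])
      fix i assume i: "i < m"
      have "(G *\<^sub>v z0) $ i \<le> h $ i"
        using ne h i by (auto simp: P_def polyhedron_def less_eq_vec_def)
      moreover have "t * (G *\<^sub>v v) $ i \<le> 0" using t(1) Gv[OF i] by (simp add: mult_nonneg_nonpos)
      ultimately show "(G *\<^sub>v z0) $ i + t * (G *\<^sub>v v) $ i \<le> h $ i" by linarith
    qed
    from below[OF this] show False using along[OF polyhedron_carrier[OF ne], of t] t(2) by linarith
  qed
  have gv: "g \<bullet> v = 0" using gv_le gv_ge by linarith
  have vv: "v \<bullet> v = 1"
    using LIMSEQ_unique[OF vec_limit_scalar_prod[OF Uv Uv]] uu by (simp add: U_def)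
  \<comment> \<open>Moving against v can only violate rows with (G v) $ i < 0, and for large j these
    have strict slack at W j, by the limit in \<open>GU\<close>.\<close>
  have "\<forall>\<^sub>F j in sequentially. \<forall>i\<in>{..<m}. (G *\<^sub>v v) $ i = 0 \<or> (G *\<^sub>v W j) $ i < h $ i"
  proof (rule eventually_ball_finite)
    show "\<forall>i\<in>{..<m}. \<forall>\<^sub>F j in sequentially. (G *\<^sub>v v) $ i = 0 \<or> (G *\<^sub>v W j) $ i < h $ i"
    proof
      fix i assume "i \<in> {..<m}"
      then have i: "i < m" by simp
      show "\<forall>\<^sub>F j in sequentially. (G *\<^sub>v v) $ i = 0 \<or> (G *\<^sub>v W j) $ i < h $ i"
      proof (cases "(G *\<^sub>v v) $ i = 0")
        case False
        with Gv[OF i] have "(G *\<^sub>v v) $ i < 0" by simp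
        from order_tendstoD(2)[OF GU[OF i] this]
        show ?thesis
        proof (rule eventually_mono)
          fix j assume "(G *\<^sub>v U j) $ i - h $ i * (1 / \<sigma> j) < 0"
          then show "(G *\<^sub>v v) $ i = 0 \<or> (G *\<^sub>v W j) $ i < h $ i"
            using GW[OF i, of j] \<sigma>pos[of j] by (simp add: field_simps)
        qed
      qed simp
    qed
  qed simp
  moreover have "\<forall>\<^sub>F j in sequentially. 0 < U j \<bullet> v"
    using order_tendstoD(1)[OF vec_limit_scalar_prod[OF Uv vec_limit_const[OF v]], of 0] vv by simp
  ultimately have "\<forall>\<^sub>F j in sequentially. 0 < U j \<bullet> v \<and>
      (\<forall>i\<in>{..<m}. (G *\<^sub>v v) $ i = 0 \<or> (G *\<^sub>v W j) $ i < h $ i)"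
    by eventually_elim simp
  then obtain j where j: "0 < U j \<bullet> v"
    "\<And>i. i < m \<Longrightarrow> (G *\<^sub>v v) $ i = 0 \<or> (G *\<^sub>v W j) $ i < h $ i"
    by (auto simp: eventually_sequentially)
  have Wv: "0 < W j \<bullet> v" using j(1) \<sigma>pos[of j] Uc[of j] v WU[of j] by simp
  have "\<forall>\<^sub>F t in at_right 0. \<forall>i\<in>{..<m}. (G *\<^sub>v W j) $ i + - t * (G *\<^sub>v v) $ i \<le> h $ i"
  proof (rule eventually_ball_finite)
    show "\<forall>i\<in>{..<m}. \<forall>\<^sub>F t in at_right 0. (G *\<^sub>v W j) $ i + - t * (G *\<^sub>v v) $ i \<le> h $ i"
    proof
      fix i assume "i \<in> {..<m}"
      then have i: "i < m" by simp
      show "\<forall>\<^sub>F t in at_right 0. (G *\<^sub>v W j) $ i + - t * (G *\<^sub>v v) $ i \<le> h $ i"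
      proof (cases "(G *\<^sub>v v) $ i = 0")
        case True
        then show ?thesis using GWh[OF i, of j] by simp
      next
        case False
        with j(2)[OF i] have "(G *\<^sub>v W j) $ i < h $ i" by simp
        moreover have "((\<lambda>t. (G *\<^sub>v W j) $ i + - t * (G *\<^sub>v v) $ i) \<longlongrightarrow>
            (G *\<^sub>v W j) $ i + - 0 * (G *\<^sub>v v) $ i) (at_right 0)"
          by (intro tendsto_intros)
        ultimately have "\<forall>\<^sub>F t in at_right 0. (G *\<^sub>v W j) $ i + - t * (G *\<^sub>v v) $ i < h $ i"
          by (intro order_tendstoD(2)) auto
        then show ?thesis by eventually_elim simp
      qed
    qed
  qed simp
  \<comment> \<open>Since v is a unit vector, |W j - t v|^2 = |W j|^2 - t (2 (W j \<bullet> v) - t),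
    so exactly the steps t in this interval shorten W j.\<close>
  moreover have "\<forall>\<^sub>F t in at_right 0. t \<in> {0<..<2 * (W j \<bullet> v)}"
    using eventually_at_right_real[of 0 "2 * (W j \<bullet> v)"] Wv by simp
  ultimately have "\<forall>\<^sub>F t in at_right 0. t \<in> {0<..<2 * (W j \<bullet> v)} \<and>
      (\<forall>i\<in>{..<m}. (G *\<^sub>v W j) $ i + - t * (G *\<^sub>v v) $ i \<le> h $ i)"
    by eventually_elim simp
  then obtain t :: real where t: "0 < t" "t < 2 * (W j \<bullet> v)"
    "\<And>i. i < m \<Longrightarrow> (G *\<^sub>v W j) $ i + - t * (G *\<^sub>v v) $ i \<le> h $ i"
    using eventually_happens'[OF trivial_limit_at_right_real] by fastforce
  have "(W j + - t \<cdot>\<^sub>v v) \<bullet> (W j + - t \<cdot>\<^sub>v v) = W j \<bullet> W j - t * (2 * (W j \<bullet> v) - t)"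
    using scalar_prod_self_add_smult[OF Wc v, of j "- t"] vv by (simp add: algebra_simps power2_eq_square)
  also have "\<dots> < W j \<bullet> W j" using t(1,2) by simp
  finally have "\<epsilon> (r j) * ((W j + - t \<cdot>\<^sub>v v) \<bullet> (W j + - t \<cdot>\<^sub>v v)) < \<epsilon> (r j) * (W j \<bullet> W j)"
    using \<epsilon>(1) by simp
  moreover have "quad H g (W j + - t \<cdot>\<^sub>v v) = quad H g (W j)"
    using along[OF Wc, of j "- t"] gv by simp
  ultimately show False
    using wmin[OF inP[OF WP t(3)], of "r j"] by (simp add: W_def)
qed

theorem convex_quadratic_attains_min:
  assumes ne: "P \<noteq> {}" and below: "\<And>z. z \<in> P \<Longrightarrow> L \<le> quad H g z"
  obtains z where "z \<in> P" "\<And>y. y \<in> P \<Longrightarrow> quad H g z \<le> quad H g y"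
proof -
  obtain z0 where z0: "z0 \<in> P" using ne by blast
  define \<epsilon> where "\<epsilon> j = inverse (real (Suc j))" for j
  have \<epsilon>: "0 < \<epsilon> j" "\<epsilon> j \<le> 1" for j by (simp_all add: \<epsilon>_def field_simps)
  have \<epsilon>0: "\<epsilon> \<longlonglongrightarrow> 0" unfolding \<epsilon>_def[abs_def] by (rule LIMSEQ_inverse_real_of_nat)
  have "\<exists>z. z \<in> P \<and> (\<forall>y\<in>P. quad H g z + \<epsilon> j * (z \<bullet> z) \<le> quad H g y + \<epsilon> j * (y \<bullet> y))" for j
    using regularized_attains_min[OF z0 below \<epsilon>(1)[of j]] by metis
  then obtain w where w: "\<And>j. w j \<in> P"
    and wmin: "\<And>j y. y \<in> P \<Longrightarrow>
      quad H g (w j) + \<epsilon> j * (w j \<bullet> w j) \<le> quad H g y + \<epsilon> j * (y \<bullet> y)" by metis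
  obtain R where R_bound: "\<forall>\<epsilon> z. 0 < \<epsilon> \<longrightarrow> \<epsilon> \<le> 1 \<longrightarrow> z \<in> P \<longrightarrow>
      (\<forall>y\<in>P. quad H g z + \<epsilon> * (z \<bullet> z) \<le> quad H g y + \<epsilon> * (y \<bullet> y)) \<longrightarrow> sqrt (z \<bullet> z) \<le> R"
    using regularized_minimizers_bounded[OF z0 below] by (rule exE)
  have R: "sqrt (w j \<bullet> w j) \<le> R" for j
    using R_bound[rule_format, OF \<epsilon>(1)[of j] \<epsilon>(2)[of j] w wmin] .
  have wc: "w j \<in> carrier_vec d" for j using w polyhedron_carrier by blast
  have "\<bar>w j $ i\<bar> \<le> R" if "i < d" for i j
    using coord_le_sqrt_scalar_prod[OF wc that, of j] R[of j] by linarith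
  then obtain r z where r: "strict_mono r" and lim: "vec_limit d (w \<circ> r) z"
    using bounded_vec_seq_limit[of w d R] wc by blast
  have "z \<in> P"
    unfolding P_def by (rule polyhedron_closed[OF G h K lim]) (use w in \<open>simp add: P_def\<close>)
  moreover have "quad H g z \<le> quad H g y" if y: "y \<in> P" for y
  proof (rule LIMSEQ_le[OF quad_continuous[OF H g lim]])
    have "(\<lambda>j. quad H g y + (\<epsilon> \<circ> r) j * (y \<bullet> y)) \<longlonglongrightarrow> quad H g y + 0 * (y \<bullet> y)"
      by (intro tendsto_intros LIMSEQ_subseq_LIMSEQ[OF \<epsilon>0 r])
    then show "(\<lambda>j. quad H g y + (\<epsilon> \<circ> r) j * (y \<bullet> y)) \<longlonglongrightarrow> quad H g y" by simp
    have "quad H g ((w \<circ> r) j) \<le> quad H g y + (\<epsilon> \<circ> r) j * (y \<bullet> y)" for j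
    proof -
      have "0 \<le> \<epsilon> (r j) * (w (r j) \<bullet> w (r j))"
        using \<epsilon>(1)[of "r j"] scalar_prod_self_nonneg[of "w (r j)"] by simp
      with wmin[OF y, of "r j"] show ?thesis by simp
    qed
    then show "\<exists>N. \<forall>j\<ge>N. quad H g ((w \<circ> r) j) \<le> quad H g y + (\<epsilon> \<circ> r) j * (y \<bullet> y)" by blast
  qed
  ultimately show ?thesis by (rule that)
qed

text \<open>The segment from z to z + u lies in P, so t \<mapsto> quad H g (z + t u) has a
  nonnegative right derivative at 0; \<open>quad_add_smult\<close> identifies that
  derivative.\<close>

lemma quad_first_order_condition:
  assumes z: "z \<in> P" "\<And>y. y \<in> P \<Longrightarrow> quad H g z \<le> quad H g y"
    and u: "u \<in> carrier_vec d" "z + u \<in> P"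
  shows "0 \<le> z \<bullet> (H *\<^sub>v u) + u \<bullet> (H *\<^sub>v z) + g \<bullet> u"
proof -
  define D where "D = z \<bullet> (H *\<^sub>v u) + u \<bullet> (H *\<^sub>v z) + g \<bullet> u"
  have zc: "z \<in> carrier_vec d" using z(1) by (rule polyhedron_carrier)
  have seg: "z + t \<cdot>\<^sub>v u \<in> P" if "0 < t" "t < 1" for t
  proof -
    have tu: "t \<cdot>\<^sub>v u \<in> carrier_vec d" using u(1) by simp
    have Gt: "G *\<^sub>v (z + t \<cdot>\<^sub>v u) = G *\<^sub>v z + t \<cdot>\<^sub>v (G *\<^sub>v u)"
      and Kt: "K *\<^sub>v (z + t \<cdot>\<^sub>v u) = K *\<^sub>v z + t \<cdot>\<^sub>v (K *\<^sub>v u)"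
      using mult_add_distrib_mat_vec[OF G zc tu] mult_mat_vec[OF G u(1)]
        mult_add_distrib_mat_vec[OF K zc tu] mult_mat_vec[OF K u(1)] by simp_all
    have "(G *\<^sub>v z + t \<cdot>\<^sub>v (G *\<^sub>v u)) $ i \<le> h $ i" if i: "i < m" for i
    proof -
      have "(G *\<^sub>v z) $ i \<le> h $ i" "(G *\<^sub>v z) $ i + (G *\<^sub>v u) $ i \<le> h $ i"
        using z(1) u(2) mult_add_distrib_mat_vec[OF G zc u(1)] G h i
        by (auto simp: P_def polyhedron_def less_eq_vec_def simp del: index_mult_mat_vec)
      then have "(1 - t) * (G *\<^sub>v z) $ i + t * ((G *\<^sub>v z) $ i + (G *\<^sub>v u) $ i) \<le> h $ i"
        using \<open>0 < t\<close> \<open>t < 1\<close> by (intro convex_bound_le) auto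
      then show ?thesis using G i by (simp add: algebra_simps)
    qed
    moreover have "K *\<^sub>v z + t \<cdot>\<^sub>v (K *\<^sub>v u) = k"
    proof -
      have k: "K *\<^sub>v z = k" "K *\<^sub>v z + K *\<^sub>v u = k"
        using z(1) u(2) mult_add_distrib_mat_vec[OF K zc u(1)]
        by (auto simp: P_def polyhedron_def)
      have "(K *\<^sub>v z) $ i + (K *\<^sub>v u) $ i = (K *\<^sub>v z) $ i" if "i < p" for i
        using k K that by (metis carrier_matD(1) dim_mult_mat_vec index_add_vec(1))
      then show ?thesis using k(1) K by (intro eq_vecI) auto
    qed
    ultimately show ?thesis
      using zc tu G h
      by (simp add: P_def polyhedron_def less_eq_vec_def Gt Kt del: index_mult_mat_vec)
  qed
  have "0 \<le> D + t * (u \<bullet> (H *\<^sub>v u))" if "0 < t" "t < 1" for t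
  proof -
    have "0 \<le> t * (D + t * (u \<bullet> (H *\<^sub>v u)))"
      using z(2)[OF seg[OF that]] quad_add_smult[OF H g zc u(1), of t]
      by (simp add: D_def algebra_simps power2_eq_square)
    with \<open>0 < t\<close> show ?thesis by (simp add: zero_le_mult_iff)
  qed
  then have "\<forall>\<^sub>F t in at_right 0. 0 \<le> D + t * (u \<bullet> (H *\<^sub>v u))"
    by (auto intro: eventually_mono[OF eventually_at_right_real[of 0 1]])
  moreover have "((\<lambda>t. D + t * (u \<bullet> (H *\<^sub>v u))) \<longlongrightarrow> D + 0 * (u \<bullet> (H *\<^sub>v u))) (at_right 0)"
    by (intro tendsto_intros)
  ultimately show ?thesis
    unfolding D_def using tendsto_lowerbound[of _ _ "at_right (0::real)" 0] by fastforce
qed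

end

section \<open>Multipliers of stationary points\<close>

lemma transpose_append_rows_mult_vec:
  fixes A B :: "real mat"
  assumes A: "A \<in> carrier_mat m n" and B: "B \<in> carrier_mat q n"
    and l: "l \<in> carrier_vec m" and v: "v \<in> carrier_vec q"
  shows "(A @\<^sub>r B)\<^sup>T *\<^sub>v (l @\<^sub>v v) = A\<^sup>T *\<^sub>v l + B\<^sup>T *\<^sub>v v"
proof (rule eq_vecI)
  fix i assume "i < dim_vec (A\<^sup>T *\<^sub>v l + B\<^sup>T *\<^sub>v v)"
  then have i: "i < n" using B by simp
  have AB: "A @\<^sub>r B \<in> carrier_mat (m + q) n" using A B by auto
  have "col (A @\<^sub>r B) i = col A i @\<^sub>v col B i"
    using A B AB i by (intro eq_vecI) (auto simp: append_rows_def)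
  then show "((A @\<^sub>r B)\<^sup>T *\<^sub>v (l @\<^sub>v v)) $ i = (A\<^sup>T *\<^sub>v l + B\<^sup>T *\<^sub>v v) $ i"
    using A B carrier_matD[OF AB] i l v scalar_prod_append[of "col A i" m "col B i" q l v] by simp
qed (use A B carrier_matD[OF carrier_append_rows[OF A B]] in auto)

text \<open>The block matrix [-I 0], which turns l \<ge> 0 into an inequality of the form G z \<le>
  0. Building it as a transpose lets \<open>transpose_append_rows_mult_vec\<close> compute its
  products.\<close>

definition neg_head :: "nat \<Rightarrow> nat \<Rightarrow> real mat" where
  "neg_head m q = (- 1\<^sub>m m @\<^sub>r 0\<^sub>m q m)\<^sup>T"

lemma neg_head_carrier: "neg_head m q \<in> carrier_mat m (m + q)"
  unfolding neg_head_def
  using carrier_append_rows[of "- 1\<^sub>m m :: real mat" m m "0\<^sub>m q m" q] by auto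

lemma neg_head_mult_vec:
  assumes "l \<in> carrier_vec m" "v \<in> carrier_vec q"
  shows "neg_head m q *\<^sub>v (l @\<^sub>v v) = - l"
proof -
  have "(- 1\<^sub>m m :: real mat)\<^sup>T = - 1\<^sub>m m" by (intro eq_matI) auto
  then show ?thesis
    unfolding neg_head_def
    using transpose_append_rows_mult_vec[of "- 1\<^sub>m m" m m "0\<^sub>m q m" q l v] assms
    by (auto simp: uminus_mult_mat_vec)
qed

lemma uminus_le_zero_vec:
  fixes l :: "real vec"
  assumes "l \<in> carrier_vec m"
  shows "- l \<le> 0\<^sub>v m \<longleftrightarrow> 0\<^sub>v m \<le> l"
  using assms by (auto simp: less_eq_vec_def)

lemma scalar_prod_nonneg:
  fixes x y :: "real vec"
  assumes "x \<in> carrier_vec m" "y \<in> carrier_vec m" "0\<^sub>v m \<le> x" "0\<^sub>v m \<le> y"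
  shows "0 \<le> x \<bullet> y"
  using assms by (auto simp: scalar_prod_def less_eq_vec_def intro!: sum_nonneg)

text \<open>
  The multipliers minimize \<open>|g + A\<^sup>T l + E\<^sup>T v|\<^sup>2 + 2 (b - A x) \<bullet> l\<close> over \<open>l \<ge> 0\<close>; the residual
  \<open>r\<close> at the minimum satisfies \<open>x - r \<in> X\<close>, and then stationarity of \<open>x\<close> forces \<open>r = 0\<close>.
\<close>

lemma stationary_point_multipliers:
  assumes A: "A \<in> carrier_mat m n" and b: "b \<in> carrier_vec m"
    and E: "E \<in> carrier_mat q n" and g: "g \<in> carrier_vec n"
    and x: "x \<in> shared_set n A b E e"
    and stat: "\<And>y. y \<in> shared_set n A b E e \<Longrightarrow> 0 \<le> g \<bullet> (y - x)"
  obtains l v where "l \<in> carrier_vec m" "v \<in> carrier_vec q" "0\<^sub>v m \<le> l"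
    "g + A\<^sup>T *\<^sub>v l + E\<^sup>T *\<^sub>v v = 0\<^sub>v n" "(b - A *\<^sub>v x) \<bullet> l = 0"
proof -
  define d where "d = m + q"
  define M where "M = A @\<^sub>r E"
  define s where "s = b - A *\<^sub>v x"
  \<comment> \<open>For z stacked from l and v, quad H c z = |g + M^T z|^2 - |g|^2 + 2 (s \<bullet>
    l), where s \<ge> 0 is the slack of x. Hence the lower bound -|g|^2.\<close>
  define H where "H = M * M\<^sup>T"
  define c where "c = 2 \<cdot>\<^sub>v (M *\<^sub>v g + (s @\<^sub>v 0\<^sub>v q))"
  \<comment> \<open>Only l \<ge> 0 is imposed: the system of equations has zero rows.\<close>
  define P where "P = polyhedron d (neg_head m q) (0\<^sub>v m) (0\<^sub>m 0 d) (0\<^sub>v 0)"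
  have xc: "x \<in> carrier_vec n" and Axb: "A *\<^sub>v x \<le> b" and Exe: "E *\<^sub>v x = e"
    using x by (auto simp: shared_set_def)
  have M: "M \<in> carrier_mat d n" and MT: "M\<^sup>T \<in> carrier_mat n d"
    using carrier_append_rows[OF A E] by (auto simp: M_def d_def)
  have H: "H \<in> carrier_mat d d" using M by (simp add: H_def)
  have s: "s \<in> carrier_vec m" "0\<^sub>v m \<le> s" using Axb A b by (auto simp: s_def less_eq_vec_def intro!: carrier_vecI)
  have s0: "s @\<^sub>v 0\<^sub>v q \<in> carrier_vec d" using s by (simp add: d_def)
  have Mg: "M *\<^sub>v g \<in> carrier_vec d" using M g by simp
  have c: "c \<in> carrier_vec d" using Mg s0 by (simp add: c_def)
  have G: "neg_head m q \<in> carrier_mat m d" by (simp add: neg_head_carrier d_def)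
  have K: "0\<^sub>m 0 d \<in> carrier_mat 0 d" by simp
  have P_iff: "l @\<^sub>v v \<in> P \<longleftrightarrow> 0\<^sub>v m \<le> l" if "l \<in> carrier_vec m" "v \<in> carrier_vec q" for l v
    using that neg_head_mult_vec[OF that] uminus_le_zero_vec[OF that(1)]
    by (auto simp: P_def polyhedron_def d_def)
  have HM: "y \<bullet> (H *\<^sub>v z) = (M\<^sup>T *\<^sub>v y) \<bullet> (M\<^sup>T *\<^sub>v z)"
    if "y \<in> carrier_vec d" "z \<in> carrier_vec d" for y z
  proof -
    have "y \<bullet> (H *\<^sub>v z) = y \<bullet> (M *\<^sub>v (M\<^sup>T *\<^sub>v z))"
      using that by (simp add: H_def assoc_mult_mat_vec[OF M MT])
    also have "\<dots> = (M\<^sup>T *\<^sub>v y) \<bullet> (M\<^sup>T *\<^sub>v z)"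
      using transpose_vec_mult_scalar[OF M _ that(1), of "M\<^sup>T *\<^sub>v z"] MT that by simp
    finally show ?thesis .
  qed
  have psd: "0 \<le> z \<bullet> (H *\<^sub>v z)" if "z \<in> carrier_vec d" for z
    using HM[OF that that] scalar_prod_self_nonneg by simp
  have Mprod: "(M *\<^sub>v y) \<bullet> z = y \<bullet> (M\<^sup>T *\<^sub>v z)" if "y \<in> carrier_vec n" "z \<in> carrier_vec d" for y z
    using transpose_vec_mult_scalar[OF M that] M MT that
      comm_scalar_prod[of "M *\<^sub>v y" d z] comm_scalar_prod[of y n "M\<^sup>T *\<^sub>v z"] by simp
  have below: "- (g \<bullet> g) \<le> quad H c z" if "z \<in> P" for z
  proof -
    have z: "z \<in> carrier_vec d" using that by (simp add: P_def polyhedron_def)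
    define l v where "l = vec_first z m" and "v = vec_last z q"
    have lv: "z = l @\<^sub>v v" "l \<in> carrier_vec m" "v \<in> carrier_vec q"
      using z by (auto simp: l_def v_def d_def)
    define a where "a = M\<^sup>T *\<^sub>v z"
    have a: "a \<in> carrier_vec n" using MT z by (simp add: a_def)
    have "c \<bullet> z = 2 * (g \<bullet> a) + 2 * (s \<bullet> l)"
      using Mprod[OF g z] scalar_prod_append[of s m "0\<^sub>v q" q l v] Mg s0 s z lv(2,3)
      by (simp add: c_def add_scalar_prod_distrib[of _ d] a_def lv(1) d_def)
    moreover have "0 \<le> s \<bullet> l" using scalar_prod_nonneg[OF s(1) lv(2) s(2)] P_iff[OF lv(2,3)] that lv(1) by simp
    moreover have "(g + a) \<bullet> (g + a) = g \<bullet> g + 2 * (g \<bullet> a) + a \<bullet> a"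
      using scalar_prod_self_add_smult[OF g a, of 1] by simp
    ultimately show ?thesis
      using scalar_prod_self_nonneg[of "g + a"] HM[OF z z] by (simp add: quad_def a_def)
  qed
  have "0\<^sub>v m @\<^sub>v 0\<^sub>v q \<in> P" by (simp add: P_iff)
  then have ne: "P \<noteq> {}" by blast
  obtain z where z: "z \<in> P" "\<And>y. y \<in> P \<Longrightarrow> quad H c z \<le> quad H c y"
    using convex_quadratic_attains_min[OF G zero_carrier_vec K H c psd ne[unfolded P_def]]
      below unfolding P_def by blast
  have zc: "z \<in> carrier_vec d" using z(1) by (simp add: P_def polyhedron_def)
  define l v where "l = vec_first z m" and "v = vec_last z q"
  have zlv: "z = l @\<^sub>v v" and l: "l \<in> carrier_vec m" and v: "v \<in> carrier_vec q"
    using zc by (auto simp: l_def v_def d_def)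
  have l0: "0\<^sub>v m \<le> l" using z(1) P_iff[OF l v] by (simp add: zlv)
  define r where "r = g + M\<^sup>T *\<^sub>v z"
  have MTz: "M\<^sup>T *\<^sub>v z \<in> carrier_vec n" using MT zc by simp
  have r: "r \<in> carrier_vec n" using g MTz by (simp add: r_def)
  have Ar: "A *\<^sub>v r \<in> carrier_vec m" and Er: "E *\<^sub>v r \<in> carrier_vec q" using A E r by simp_all
  have Mr: "M *\<^sub>v r = (A *\<^sub>v r) @\<^sub>v (E *\<^sub>v r)" using mat_mult_append[OF A E r] by (simp add: M_def)
  \<comment> \<open>Half the gradient at z is M r + (s, 0), that is (A r + s, E r). A direction (y,
    w) is admissible as long as l + y stays nonnegative.\<close>
  have foc: "0 \<le> (A *\<^sub>v r + s) \<bullet> y + (E *\<^sub>v r) \<bullet> w"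
    if y: "y \<in> carrier_vec m" "0\<^sub>v m \<le> l + y" and w: "w \<in> carrier_vec q" for y w
  proof -
    have yw: "y @\<^sub>v w \<in> carrier_vec d" using y w by (simp add: d_def)
    have "z + (y @\<^sub>v w) = (l + y) @\<^sub>v (v + w)"
      using append_vec_add[OF l y(1) v w] by (simp add: zlv)
    then have zyw: "z + (y @\<^sub>v w) \<in> P" using P_iff[of "l + y" "v + w"] l v y w by simp
    have "0 \<le> z \<bullet> (H *\<^sub>v (y @\<^sub>v w)) + (y @\<^sub>v w) \<bullet> (H *\<^sub>v z) + c \<bullet> (y @\<^sub>v w)"
      using quad_first_order_condition[OF G zero_carrier_vec K H c psd
          z[unfolded P_def] yw zyw[unfolded P_def]] .
    also have "\<dots> = 2 * ((M\<^sup>T *\<^sub>v z) \<bullet> (M\<^sup>T *\<^sub>v (y @\<^sub>v w))) + c \<bullet> (y @\<^sub>v w)"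
      using HM[OF zc yw] HM[OF yw zc] MT yw MTz
        comm_scalar_prod[of "M\<^sup>T *\<^sub>v (y @\<^sub>v w)" n "M\<^sup>T *\<^sub>v z"] by simp
    also have "(M\<^sup>T *\<^sub>v z) \<bullet> (M\<^sup>T *\<^sub>v (y @\<^sub>v w)) = (M *\<^sub>v (M\<^sup>T *\<^sub>v z)) \<bullet> (y @\<^sub>v w)"
      using Mprod[OF MTz yw] by simp
    also have "c \<bullet> (y @\<^sub>v w) = 2 * ((M *\<^sub>v g) \<bullet> (y @\<^sub>v w) + s \<bullet> y)"
      using scalar_prod_append[of s m "0\<^sub>v q" q y w] Mg s0 s yw y w
      by (simp add: c_def add_scalar_prod_distrib[of _ d])
    finally have "0 \<le> (M *\<^sub>v g) \<bullet> (y @\<^sub>v w) + (M *\<^sub>v (M\<^sup>T *\<^sub>v z)) \<bullet> (y @\<^sub>v w) + s \<bullet> y" by simp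
    also have "(M *\<^sub>v g) \<bullet> (y @\<^sub>v w) + (M *\<^sub>v (M\<^sup>T *\<^sub>v z)) \<bullet> (y @\<^sub>v w) = (M *\<^sub>v r) \<bullet> (y @\<^sub>v w)"
      using mult_add_distrib_mat_vec[OF M g MTz] Mg M MTz yw
      by (simp add: r_def add_scalar_prod_distrib[of _ d])
    also have "\<dots> = (A *\<^sub>v r) \<bullet> y + (E *\<^sub>v r) \<bullet> w"
      unfolding Mr using scalar_prod_append[OF Ar Er y(1) w] .
    finally show ?thesis using Ar s y by (simp add: add_scalar_prod_distrib[of _ m])
  qed
  \<comment> \<open>Three test directions: a unit vector in the l part gives A r + s \<ge> 0, (0, -
    E r) gives E r = 0, and (- l, 0) gives the complementarity bound \<open>lcomp\<close>.\<close>
  have Ars: "0 \<le> (A *\<^sub>v r + s) $ i" if i: "i < m" for i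
  proof -
    have "0\<^sub>v m \<le> l + unit_vec m i" using l0 l by (auto simp: less_eq_vec_def unit_vec_def)
    from foc[OF _ this, of "0\<^sub>v q"] show ?thesis using Ar Er s i by simp
  qed
  have Er0: "E *\<^sub>v r = 0\<^sub>v q"
  proof (rule scalar_prod_self_eq_0[OF Er])
    have "0 \<le> (A *\<^sub>v r + s) \<bullet> 0\<^sub>v m + (E *\<^sub>v r) \<bullet> - (E *\<^sub>v r)"
      by (rule foc) (use l l0 Er in auto)
    then show "(E *\<^sub>v r) \<bullet> (E *\<^sub>v r) \<le> 0" using Ar s Er by simp
  qed
  have lcomp: "(A *\<^sub>v r + s) \<bullet> l \<le> 0"
  proof -
    have "0 \<le> (A *\<^sub>v r + s) \<bullet> - l + (E *\<^sub>v r) \<bullet> 0\<^sub>v q"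
      by (rule foc) (use l in \<open>auto simp: less_eq_vec_def\<close>)
    then show ?thesis using Ar s Er l by simp
  qed
  \<comment> \<open>The slack at x - r is A r + s, and E r = 0 preserves the equations.\<close>
  have "x - r \<in> shared_set n A b E e"
  proof -
    have "(A *\<^sub>v x) $ i - (A *\<^sub>v r) $ i \<le> b $ i" if "i < m" for i
      using Ars[OF that] A b that by (simp add: s_def)
    then have "A *\<^sub>v (x - r) \<le> b"
      using mult_minus_distrib_mat_vec[OF A xc r] A b by (simp add: less_eq_vec_def)
    moreover have "E *\<^sub>v (x - r) = e"
      using mult_minus_distrib_mat_vec[OF E xc r] Er0 Exe E xc by auto
    ultimately show ?thesis using xc r by (simp add: shared_set_def)
  qed
  from stat[OF this] have "0 \<le> g \<bullet> ((x - r) - x)" .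
  also have "(x - r) - x = - r" using xc r by (intro eq_vecI) auto
  finally have gr: "g \<bullet> r \<le> 0" using g r by simp
  \<comment> \<open>Pairing r = g + M^T z with r gives |r|^2 = g \<bullet> r + (A r) \<bullet> l.
    Stationarity bounds the first term by 0 and \<open>lcomp\<close> the second by - (s \<bullet>
    l), so |r|^2 and s \<bullet> l both vanish.\<close>
  have "r \<bullet> r = g \<bullet> r + (M\<^sup>T *\<^sub>v z) \<bullet> r"
    using g MTz r by (subst (1) r_def) (simp add: add_scalar_prod_distrib[of _ n])
  also have "(M\<^sup>T *\<^sub>v z) \<bullet> r = (M *\<^sub>v r) \<bullet> z"
    using Mprod[OF r zc] comm_scalar_prod[OF MTz r] by simp
  also have "\<dots> = (A *\<^sub>v r) \<bullet> l"
    unfolding Mr zlv using scalar_prod_append[OF Ar Er l v] Er0 v by simp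
  finally have rr: "r \<bullet> r + s \<bullet> l \<le> 0"
    using gr lcomp Ar s l by (simp add: add_scalar_prod_distrib[of _ m])
  have sl: "0 \<le> s \<bullet> l" by (rule scalar_prod_nonneg[OF s(1) l s(2) l0])
  have "r = 0\<^sub>v n" using scalar_prod_self_eq_0[OF r] rr sl by simp
  moreover have "r = g + A\<^sup>T *\<^sub>v l + E\<^sup>T *\<^sub>v v"
    using transpose_append_rows_mult_vec[OF A E l v] assoc_add_vec[OF g, of "A\<^sup>T *\<^sub>v l" "E\<^sup>T *\<^sub>v v"] A E l v
    by (simp add: r_def M_def zlv)
  moreover have "s \<bullet> l = 0" using rr sl scalar_prod_self_nonneg[of r] by linarith
  ultimately show ?thesis using that[OF l v l0] by (simp add: s_def)
qed

section \<open>The quadratic program of the game\<close>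

lemma sym_part_carrier: "F \<in> carrier_mat n n \<Longrightarrow> sym_part F \<in> carrier_mat n n"
  by (simp add: sym_part_def)

text \<open>The skew part of F contributes nothing to the form. This reconciles the objective,
  written with \<open>sym_part F\<close>, with the equality constraint, written with F.\<close>

lemma scalar_prod_sym_part:
  assumes F: "F \<in> carrier_mat n n" and x: "x \<in> carrier_vec n"
  shows "x \<bullet> (sym_part F *\<^sub>v x) = x \<bullet> (F *\<^sub>v x)"
proof -
  have FT: "F\<^sup>T \<in> carrier_mat n n" using F by simp
  have c: "F *\<^sub>v x \<in> carrier_vec n" "F\<^sup>T *\<^sub>v x \<in> carrier_vec n" using F x by simp_all
  have "sym_part F *\<^sub>v x = (1/2) \<cdot>\<^sub>v (F *\<^sub>v x + F\<^sup>T *\<^sub>v x)"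
  proof (rule eq_vecI)
    fix i assume "i < dim_vec ((1/2) \<cdot>\<^sub>v (F *\<^sub>v x + F\<^sup>T *\<^sub>v x))"
    then have i: "i < n" using F by simp
    have "row (sym_part F) i = (1/2) \<cdot>\<^sub>v (row F i + row (F\<^sup>T) i)"
      using i F by (intro eq_vecI) (auto simp: sym_part_def)
    moreover have "row F i \<in> carrier_vec n" "row (F\<^sup>T) i \<in> carrier_vec n" using F i by auto
    ultimately show "(sym_part F *\<^sub>v x) $ i = ((1/2) \<cdot>\<^sub>v (F *\<^sub>v x + F\<^sup>T *\<^sub>v x)) $ i"
      using i F x carrier_matD[OF sym_part_carrier[OF F]] by (simp add: add_scalar_prod_distrib[of _ n])
  qed (use F carrier_matD[OF sym_part_carrier[OF F]] in auto)
  moreover have "x \<bullet> (F\<^sup>T *\<^sub>v x) = x \<bullet> (F *\<^sub>v x)"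
    using transpose_vec_mult_scalar[OF F x x] comm_scalar_prod[OF c(2) x] by simp
  ultimately show ?thesis using x c by (simp add: scalar_prod_add_distrib[of _ n])
qed

context
  fixes n m q :: nat and A E F :: "real mat" and b e f :: "real vec"
  assumes A: "A \<in> carrier_mat m n" and b: "b \<in> carrier_vec m"
    and E: "E \<in> carrier_mat q n" and e: "e \<in> carrier_vec q"
    and F: "F \<in> carrier_mat n n" and f: "f \<in> carrier_vec n"
begin

lemma qp_feasible_iff:
  "(x, l, v) \<in> qp_feasible F f A b E e \<longleftrightarrow>
    x \<in> shared_set n A b E e \<and> l \<in> carrier_vec m \<and> v \<in> carrier_vec q \<and> 0\<^sub>v m \<le> l \<and>
    F *\<^sub>v x + f + A\<^sup>T *\<^sub>v l + E\<^sup>T *\<^sub>v v = 0\<^sub>v n"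
  using A E F by (auto simp: qp_feasible_def shared_set_def)

text \<open>Pair the stationarity equation with y and move the transposes across. At y = x this
  evaluates the objective, at differences y - x the variational inequality.\<close>

lemma multiplier_identity:
  assumes S: "(x, l, v) \<in> qp_feasible F f A b E e" and y: "y \<in> carrier_vec n"
  shows "(F *\<^sub>v x + f) \<bullet> y = - ((A *\<^sub>v y) \<bullet> l) - (E *\<^sub>v y) \<bullet> v"
proof -
  have x: "x \<in> carrier_vec n" and l: "l \<in> carrier_vec m" and v: "v \<in> carrier_vec q"
    and eq: "F *\<^sub>v x + f + A\<^sup>T *\<^sub>v l + E\<^sup>T *\<^sub>v v = 0\<^sub>v n"
    using S by (auto simp: qp_feasible_iff shared_set_def)
  have c: "F *\<^sub>v x + f \<in> carrier_vec n" "A\<^sup>T *\<^sub>v l \<in> carrier_vec n" "E\<^sup>T *\<^sub>v v \<in> carrier_vec n"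
    using F f A E x l v by auto
  have "0 = (F *\<^sub>v x + f + A\<^sup>T *\<^sub>v l + E\<^sup>T *\<^sub>v v) \<bullet> y" using y by (simp add: eq)
  also have "\<dots> = (F *\<^sub>v x + f) \<bullet> y + (A\<^sup>T *\<^sub>v l) \<bullet> y + (E\<^sup>T *\<^sub>v v) \<bullet> y"
    using c y by (simp add: add_scalar_prod_distrib[of _ n])
  also have "(A\<^sup>T *\<^sub>v l) \<bullet> y = (A *\<^sub>v y) \<bullet> l"
    using transpose_vec_mult_scalar[OF A y l] comm_scalar_prod[OF l, of "A *\<^sub>v y"] A y by simp
  also have "(E\<^sup>T *\<^sub>v v) \<bullet> y = (E *\<^sub>v y) \<bullet> v"
    using transpose_vec_mult_scalar[OF E y v] comm_scalar_prod[OF v, of "E *\<^sub>v y"] E y by simp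
  finally show ?thesis by linarith
qed

lemma qp_objective_feasible:
  assumes S: "(x, l, v) \<in> qp_feasible F f A b E e"
  shows "qp_objective F f b e (x, l, v) = (b - A *\<^sub>v x) \<bullet> l"
proof -
  have x: "x \<in> carrier_vec n" and l: "l \<in> carrier_vec m" and v: "v \<in> carrier_vec q"
    and Ex: "E *\<^sub>v x = e"
    using S by (auto simp: qp_feasible_iff shared_set_def)
  have c: "F *\<^sub>v x \<in> carrier_vec n" "A *\<^sub>v x \<in> carrier_vec m" using F A x by auto
  have "x \<bullet> (sym_part F *\<^sub>v x) + f \<bullet> x = (F *\<^sub>v x + f) \<bullet> x"
    using scalar_prod_sym_part[OF F x] comm_scalar_prod[OF x c(1)] c x f
    by (simp add: add_scalar_prod_distrib[of _ n])
  then show ?thesis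
    using multiplier_identity[OF S x] Ex c b l by (simp add: minus_scalar_prod_distrib[of _ m])
qed

lemma qp_objective_nonneg:
  assumes "(x, l, v) \<in> qp_feasible F f A b E e"
  shows "0 \<le> qp_objective F f b e (x, l, v)"
proof -
  have "0\<^sub>v m \<le> b - A *\<^sub>v x" "b - A *\<^sub>v x \<in> carrier_vec m"
    using assms A b by (auto simp: qp_feasible_iff shared_set_def less_eq_vec_def intro!: carrier_vecI)
  then show ?thesis
    unfolding qp_objective_feasible[OF assms]
    using assms by (auto simp: qp_feasible_iff intro: scalar_prod_nonneg)
qed

text \<open>For y in X the equality multipliers drop out of \<open>multiplier_identity\<close>,
  leaving (F x + f) \<bullet> (y - x) = (b - A y) \<bullet> l - (b - A x) \<bullet> l. The last
  product is the objective, which is zero; the other pairs nonnegative vectors.\<close>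

lemma vGNE_if_objective_zero:
  assumes S: "(x, l, v) \<in> qp_feasible F f A b E e" and 0: "qp_objective F f b e (x, l, v) = 0"
  shows "is_vGNE (\<lambda>x. F *\<^sub>v x + f) (shared_set n A b E e) x"
proof -
  have x: "x \<in> shared_set n A b E e" "x \<in> carrier_vec n" and l: "l \<in> carrier_vec m" "0\<^sub>v m \<le> l"
    and v: "v \<in> carrier_vec q"
    using S by (auto simp: qp_feasible_iff shared_set_def)
  have Ax: "A *\<^sub>v x \<in> carrier_vec m" using A x by simp
  have "0 \<le> (F *\<^sub>v x + f) \<bullet> (y - x)" if "y \<in> shared_set n A b E e" for y
  proof -
    have y: "y \<in> carrier_vec n" "A *\<^sub>v y \<le> b" "E *\<^sub>v y = e" using that by (auto simp: shared_set_def)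
    have Ay: "A *\<^sub>v y \<in> carrier_vec m" using A y by simp
    have "0\<^sub>v m \<le> b - A *\<^sub>v y" "b - A *\<^sub>v y \<in> carrier_vec m"
      using y A b by (auto simp: less_eq_vec_def intro!: carrier_vecI)
    then have "0 \<le> (b - A *\<^sub>v y) \<bullet> l" using scalar_prod_nonneg l by blast
    moreover have "E *\<^sub>v (y - x) = 0\<^sub>v q"
      using mult_minus_distrib_mat_vec[OF E y(1) x(2)] x(1) y(3) e by (simp add: shared_set_def)
    moreover have "(A *\<^sub>v (y - x)) \<bullet> l = (A *\<^sub>v y) \<bullet> l - (A *\<^sub>v x) \<bullet> l"
      using mult_minus_distrib_mat_vec[OF A y(1) x(2)] Ax Ay l
      by (simp add: minus_scalar_prod_distrib[of _ m])
    ultimately show ?thesis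
      using multiplier_identity[OF S, of "y - x"] qp_objective_feasible[OF S] 0 x y v b l Ax Ay
      by (simp add: minus_scalar_prod_distrib[of _ m])
  qed
  with x show ?thesis by (simp add: is_vGNE_def)
qed

text \<open>With g frozen at F x + f, the variational inequality says that x minimizes a linear
  function over X, the situation of \<open>stationary_point_multipliers\<close>.\<close>

lemma vGNE_imp_objective_zero:
  assumes x: "is_vGNE (\<lambda>x. F *\<^sub>v x + f) (shared_set n A b E e) x"
  obtains l v where "(x, l, v) \<in> qp_feasible F f A b E e" "qp_objective F f b e (x, l, v) = 0"
proof -
  have "F *\<^sub>v x + f \<in> carrier_vec n"
    using x F f by (auto simp: is_vGNE_def shared_set_def)
  from stationary_point_multipliers[OF A b E this, of x e] x
  obtain l v where "l \<in> carrier_vec m" "v \<in> carrier_vec q" "0\<^sub>v m \<le> l"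
    "F *\<^sub>v x + f + A\<^sup>T *\<^sub>v l + E\<^sup>T *\<^sub>v v = 0\<^sub>v n" "(b - A *\<^sub>v x) \<bullet> l = 0"
    unfolding is_vGNE_def by blast
  then show ?thesis
    using that x qp_objective_feasible by (auto simp: is_vGNE_def qp_feasible_iff)
qed

text \<open>Puts the program into the form of \<open>convex_quadratic_attains_min\<close>; the lower
  bound asked for there is 0, from \<open>qp_objective_nonneg\<close>.\<close>

lemma qp_attains_min:
  assumes psd: "\<And>x. x \<in> carrier_vec n \<Longrightarrow> 0 \<le> x \<bullet> (F *\<^sub>v x)"
    and ne: "qp_feasible F f A b E e \<noteq> {}"
  obtains x l v where "(x, l, v) \<in> qp_feasible F f A b E e"
    "\<And>z. z \<in> qp_feasible F f A b E e \<Longrightarrow> qp_objective F f b e (x, l, v) \<le> qp_objective F f b e z"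
proof -
  \<comment> \<open>On z = (x, l, v) the blocks act as G z = (A x, - l), K z = (F x + A^T l + E^T v,
    E x) and H z = (F_s x, 0, 0); the constant f moves to the right-hand side as - f.\<close>
  define M where "M = (A @\<^sub>r E)\<^sup>T"
  define G where "G = four_block_mat A (0\<^sub>m m (m + q)) (0\<^sub>m m n) (neg_head m q)"
  define K where "K = four_block_mat F M E (0\<^sub>m q (m + q))"
  define H where "H = four_block_mat (sym_part F) (0\<^sub>m n (m + q)) (0\<^sub>m (m + q) n) (0\<^sub>m (m + q) (m + q))"
  define g where "g = f @\<^sub>v b @\<^sub>v e"
  define d where "d = n + (m + q)"
  define P where "P = polyhedron d G (b @\<^sub>v 0\<^sub>v m) K (- f @\<^sub>v e)"
  have M: "M \<in> carrier_mat n (m + q)" using carrier_append_rows[OF A E] by (simp add: M_def)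
  have G: "G \<in> carrier_mat (m + m) d" using A neg_head_carrier by (simp add: G_def d_def)
  have K: "K \<in> carrier_mat (n + q) d" using F by (simp add: K_def d_def)
  have H: "H \<in> carrier_mat d d" using sym_part_carrier[OF F] by (simp add: H_def d_def)
  have g: "g \<in> carrier_vec d" using f b e by (simp add: g_def d_def)
  have h: "b @\<^sub>v 0\<^sub>v m \<in> carrier_vec (m + m)" using b by simp
  have P_iff: "x @\<^sub>v l @\<^sub>v v \<in> P \<longleftrightarrow> (x, l, v) \<in> qp_feasible F f A b E e"
    and quad: "quad H g (x @\<^sub>v l @\<^sub>v v) = qp_objective F f b e (x, l, v)"
    and psdH: "0 \<le> (x @\<^sub>v l @\<^sub>v v) \<bullet> (H *\<^sub>v (x @\<^sub>v l @\<^sub>v v))"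
    if x: "x \<in> carrier_vec n" and l: "l \<in> carrier_vec m" and v: "v \<in> carrier_vec q" for x l v
  proof -
    have lv: "l @\<^sub>v v \<in> carrier_vec (m + q)" using l v by simp
    have c: "F *\<^sub>v x \<in> carrier_vec n" "A\<^sup>T *\<^sub>v l \<in> carrier_vec n" "E\<^sup>T *\<^sub>v v \<in> carrier_vec n"
      "A *\<^sub>v x \<in> carrier_vec m" "E *\<^sub>v x \<in> carrier_vec q" "sym_part F *\<^sub>v x \<in> carrier_vec n"
      using A E F x l v sym_part_carrier[OF F] by auto
    have "G *\<^sub>v (x @\<^sub>v l @\<^sub>v v) =
        (A *\<^sub>v x + 0\<^sub>m m (m + q) *\<^sub>v (l @\<^sub>v v)) @\<^sub>v (0\<^sub>m m n *\<^sub>v x + neg_head m q *\<^sub>v (l @\<^sub>v v))"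
      unfolding G_def
      by (rule four_block_mat_mult_vec[OF A zero_carrier_mat zero_carrier_mat neg_head_carrier x lv])
    also have "0\<^sub>m m (m + q) *\<^sub>v (l @\<^sub>v v) = 0\<^sub>v m" using lv by auto
    also have "0\<^sub>m m n *\<^sub>v x = 0\<^sub>v m" using x by auto
    finally have "G *\<^sub>v (x @\<^sub>v l @\<^sub>v v) = (A *\<^sub>v x) @\<^sub>v - l"
      using c l neg_head_mult_vec[OF l v] by simp
    then have Gle: "G *\<^sub>v (x @\<^sub>v l @\<^sub>v v) \<le> b @\<^sub>v 0\<^sub>v m \<longleftrightarrow> A *\<^sub>v x \<le> b \<and> 0\<^sub>v m \<le> l"
      using append_vec_le[OF c(4) b] uminus_le_zero_vec[OF l] by simp
    have "K *\<^sub>v (x @\<^sub>v l @\<^sub>v v) = (F *\<^sub>v x + M *\<^sub>v (l @\<^sub>v v)) @\<^sub>v (E *\<^sub>v x + 0\<^sub>m q (m + q) *\<^sub>v (l @\<^sub>v v))"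
      unfolding K_def by (rule four_block_mat_mult_vec[OF F M E zero_carrier_mat x lv])
    also have "0\<^sub>m q (m + q) *\<^sub>v (l @\<^sub>v v) = 0\<^sub>v q" using lv by auto
    also have "M *\<^sub>v (l @\<^sub>v v) = A\<^sup>T *\<^sub>v l + E\<^sup>T *\<^sub>v v"
      unfolding M_def by (rule transpose_append_rows_mult_vec[OF A E l v])
    finally have "K *\<^sub>v (x @\<^sub>v l @\<^sub>v v) = (F *\<^sub>v x + (A\<^sup>T *\<^sub>v l + E\<^sup>T *\<^sub>v v)) @\<^sub>v (E *\<^sub>v x)"
      using c by simp
    moreover have "F *\<^sub>v x + (A\<^sup>T *\<^sub>v l + E\<^sup>T *\<^sub>v v) = - f \<longleftrightarrow>
        F *\<^sub>v x + f + A\<^sup>T *\<^sub>v l + E\<^sup>T *\<^sub>v v = 0\<^sub>v n"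
    proof -
      have "\<forall>i<n. (F *\<^sub>v x + (A\<^sup>T *\<^sub>v l + E\<^sup>T *\<^sub>v v)) $ i = (- f) $ i \<longleftrightarrow>
          (F *\<^sub>v x + f + A\<^sup>T *\<^sub>v l + E\<^sup>T *\<^sub>v v) $ i = 0\<^sub>v n $ i"
        using c f E by (auto simp del: index_mult_mat_vec)
      then show ?thesis
        using c f by (auto simp: vec_eq_iff simp del: index_mult_mat_vec index_add_vec(1) index_uminus_vec(1))
    qed
    ultimately have Keq: "K *\<^sub>v (x @\<^sub>v l @\<^sub>v v) = - f @\<^sub>v e \<longleftrightarrow>
        F *\<^sub>v x + f + A\<^sup>T *\<^sub>v l + E\<^sup>T *\<^sub>v v = 0\<^sub>v n \<and> E *\<^sub>v x = e"
      using append_vec_eq[of "F *\<^sub>v x + (A\<^sup>T *\<^sub>v l + E\<^sup>T *\<^sub>v v)" n "- f"] c f by simp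
    show "x @\<^sub>v l @\<^sub>v v \<in> P \<longleftrightarrow> (x, l, v) \<in> qp_feasible F f A b E e"
      using Gle Keq x l v by (auto simp: P_def polyhedron_def d_def qp_feasible_iff shared_set_def)
    have "H *\<^sub>v (x @\<^sub>v l @\<^sub>v v) = (sym_part F *\<^sub>v x) @\<^sub>v (0\<^sub>m (m + q) (m + q) *\<^sub>v (l @\<^sub>v v))"
      unfolding H_def by (rule mult_mat_vec_split[OF sym_part_carrier[OF F] zero_carrier_mat x lv])
    also have "0\<^sub>m (m + q) (m + q) *\<^sub>v (l @\<^sub>v v) = 0\<^sub>v (m + q)" using lv by auto
    finally have xHx: "(x @\<^sub>v l @\<^sub>v v) \<bullet> (H *\<^sub>v (x @\<^sub>v l @\<^sub>v v)) = x \<bullet> (sym_part F *\<^sub>v x)"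
      using scalar_prod_append[OF x lv c(6) zero_carrier_vec] lv by simp
    then show "0 \<le> (x @\<^sub>v l @\<^sub>v v) \<bullet> (H *\<^sub>v (x @\<^sub>v l @\<^sub>v v))"
      using psd[OF x] scalar_prod_sym_part[OF F x] by simp
    have "g \<bullet> (x @\<^sub>v l @\<^sub>v v) = f \<bullet> x + (b \<bullet> l + e \<bullet> v)"
      unfolding g_def using scalar_prod_append[OF f _ x lv, of "b @\<^sub>v e"] scalar_prod_append[OF b e l v] b e
      by simp
    with xHx show "quad H g (x @\<^sub>v l @\<^sub>v v) = qp_objective F f b e (x, l, v)"
      by (simp add: quad_def)
  qed
  have split: "\<exists>x l v. z = x @\<^sub>v l @\<^sub>v v \<and> x \<in> carrier_vec n \<and> l \<in> carrier_vec m \<and> v \<in> carrier_vec q"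
    if "z \<in> carrier_vec d" for z :: "real vec"
  proof -
    have "vec_last z (m + q) \<in> carrier_vec (m + q)" by simp
    with that show ?thesis
      unfolding d_def by (metis vec_first_last_append vec_first_carrier vec_last_carrier)
  qed
  have psd': "0 \<le> z \<bullet> (H *\<^sub>v z)" if "z \<in> carrier_vec d" for z
    using split[OF that] psdH by auto
  have P_split: "\<exists>x l v. z = x @\<^sub>v l @\<^sub>v v \<and> (x, l, v) \<in> qp_feasible F f A b E e \<and>
      quad H g z = qp_objective F f b e (x, l, v)" if "z \<in> P" for z
  proof -
    have "z \<in> carrier_vec d" using that by (simp add: P_def polyhedron_def)
    with split obtain x l v where "z = x @\<^sub>v l @\<^sub>v v" "x \<in> carrier_vec n" "l \<in> carrier_vec m"
      "v \<in> carrier_vec q" by blast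
    with that P_iff quad show ?thesis by blast
  qed
  have S_P: "x @\<^sub>v l @\<^sub>v v \<in> P \<and> quad H g (x @\<^sub>v l @\<^sub>v v) = qp_objective F f b e (x, l, v)"
    if "(x, l, v) \<in> qp_feasible F f A b E e" for x l v
    using that P_iff quad by (auto simp: qp_feasible_iff shared_set_def)
  have ne': "P \<noteq> {}" using ne S_P by fast
  have below: "0 \<le> quad H g z" if "z \<in> P" for z
    using P_split[OF that] qp_objective_nonneg by force
  obtain z where z: "z \<in> P" "\<And>y. y \<in> P \<Longrightarrow> quad H g z \<le> quad H g y"
    using convex_quadratic_attains_min[OF G h K H g psd' ne'[unfolded P_def] below[unfolded P_def]]
    unfolding P_def by blast
  obtain x l v where xlv: "(x, l, v) \<in> qp_feasible F f A b E e" "quad H g z = qp_objective F f b e (x, l, v)"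
    using P_split[OF z(1)] by blast
  have "qp_objective F f b e (x, l, v) \<le> qp_objective F f b e (x', l', v')"
    if "(x', l', v') \<in> qp_feasible F f A b E e" for x' l' v'
    using S_P[OF that] z(2) xlv(2) by metis
  then show ?thesis using that[OF xlv(1)] by (metis prod_cases3)
qed

end

lemma optimal_value_eq_minimum:
  assumes "z \<in> S" "\<And>y. y \<in> S \<Longrightarrow> g z \<le> g y"
  shows "optimal_value S g = ereal (g z)"
  unfolding optimal_value_def
  by (rule antisym) (use assms in \<open>auto intro: INF_lower INF_greatest\<close>)

theorem lemma3p1:
  fixes N n m q :: nat and ns :: "nat \<Rightarrow> nat"
    and Q :: "nat \<Rightarrow> real mat" and c :: "nat \<Rightarrow> real vec"
    and A E F :: "real mat" and b e f :: "real vec"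
    and \<phi> :: "real vec \<Rightarrow> real vec" and X :: "real vec set"
    and S :: "(real vec \<times> real vec \<times> real vec) set"
    and obj :: "real vec \<times> real vec \<times> real vec \<Rightarrow> real"
  assumes n: "n = joint_dim N ns"
    and Q: "\<And>i. i < N \<Longrightarrow> Q i \<in> carrier_mat n n"
    and Q_sym: "\<And>i. i < N \<Longrightarrow> (Q i)\<^sup>T = Q i"
    and c: "\<And>i. i < N \<Longrightarrow> c i \<in> carrier_vec n"
    and A: "A \<in> carrier_mat m n" and b: "b \<in> carrier_vec m"
    and E: "E \<in> carrier_mat q n" and e: "e \<in> carrier_vec q"
    and F: "F = pg_mat N ns Q" and f: "f = pg_vec N ns c"
    and \<phi>: "\<phi> = pseudogradient N ns Q c"
    and mono: "monotone_map n \<phi>"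
    and X: "X = shared_set n A b E e"
    and S: "S = qp_feasible F f A b E e"
    and obj: "obj = qp_objective F f b e"
  shows "(S = {} \<longrightarrow> \<not> (\<exists>x. is_vGNE \<phi> X x)) \<and>
    (S \<noteq> {} \<longrightarrow>
      \<bar>optimal_value S obj\<bar> \<noteq> \<infinity> \<and> 0 \<le> optimal_value S obj \<and>
      (\<exists>x l v. is_minimizer S obj (x, l, v)) \<and>
      (\<forall>x l v. is_minimizer S obj (x, l, v) \<longrightarrow>
        (is_vGNE \<phi> X x \<longleftrightarrow> optimal_value S obj = 0)))"
proof -
  have Fc: "F \<in> carrier_mat n n" and fc: "f \<in> carrier_vec n"
    by (simp_all add: F f n pg_mat_def pg_vec_def)
  have \<phi>': "\<phi> = (\<lambda>x. F *\<^sub>v x + f)" by (simp add: \<phi> F f pseudogradient_def fun_eq_iff)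
  \<comment> \<open>The map is affine, so monotonicity on the pair x, 0 is the inequality 0 \<le> x
    \<bullet> (F x).\<close>
  have psd: "0 \<le> x \<bullet> (F *\<^sub>v x)" if x: "x \<in> carrier_vec n" for x
  proof -
    have Fx: "F *\<^sub>v x \<in> carrier_vec n" using Fc x by simp
    have "F *\<^sub>v 0\<^sub>v n = 0\<^sub>v n" using Fc by auto
    then have "\<phi> x - \<phi> (0\<^sub>v n) = F *\<^sub>v x" using Fc Fx fc
      by (intro eq_vecI) (auto simp: \<phi>' simp del: index_mult_mat_vec)
    moreover have "x - 0\<^sub>v n = x" using x by simp
    moreover have "0 \<le> (\<phi> x - \<phi> (0\<^sub>v n)) \<bullet> (x - 0\<^sub>v n)"
      using mono x zero_carrier_vec unfolding monotone_map_def by blast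
    ultimately show ?thesis using comm_scalar_prod[OF x Fx] by simp
  qed
  note ctx = A b E e Fc fc
  have obj_nonneg: "0 \<le> obj z" if "z \<in> S" for z
    using qp_objective_nonneg[OF ctx] that unfolding S obj by (metis prod_cases3)
  have necessary: "\<exists>l v. (x, l, v) \<in> S \<and> obj (x, l, v) = 0" if "is_vGNE \<phi> X x" for x
    using vGNE_imp_objective_zero[OF ctx that[unfolded \<phi>' X]] unfolding S obj by blast
  have sufficient: "is_vGNE \<phi> X x" if "(x, l, v) \<in> S" "obj (x, l, v) = 0" for x l v
    using vGNE_if_objective_zero[OF ctx that[unfolded S obj]] unfolding \<phi>' X .
  show ?thesis
  proof (intro conjI impI)
    show "\<not> (\<exists>x. is_vGNE \<phi> X x)" if "S = {}" using necessary that by blast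
  next
    assume "S \<noteq> {}"
    then obtain x l v where min: "(x, l, v) \<in> S" "\<And>z. z \<in> S \<Longrightarrow> obj (x, l, v) \<le> obj z"
      using qp_attains_min[OF ctx psd] unfolding S obj by metis
    have val: "optimal_value S obj = ereal (obj (x, l, v))"
      using min by (rule optimal_value_eq_minimum)
    show "\<bar>optimal_value S obj\<bar> \<noteq> \<infinity>" by (simp add: val)
    show "0 \<le> optimal_value S obj" using obj_nonneg[OF min(1)] by (simp add: val)
    show "\<exists>x l v. is_minimizer S obj (x, l, v)"
      using min(1) val unfolding is_minimizer_def by metis
    show "\<forall>x l v. is_minimizer S obj (x, l, v) \<longrightarrow> (is_vGNE \<phi> X x \<longleftrightarrow> optimal_value S obj = 0)"
    proof (intro allI impI iffI)
      \<comment> \<open>The multipliers l0, v0 of the v-GNE may differ from l', v'. A feasible point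
        of value zero still forces the optimal value to be zero, since no value is negative.\<close>
      fix x' l' v' assume "is_minimizer S obj (x', l', v')" and "is_vGNE \<phi> X x'"
      from necessary[OF this(2)] obtain l0 v0 where "(x', l0, v0) \<in> S" "obj (x', l0, v0) = 0" by blast
      with min(2)[of "(x', l0, v0)"] obj_nonneg[OF min(1)]
      show "optimal_value S obj = 0" by (simp add: val zero_ereal_def)
    next
      fix x' l' v' assume "is_minimizer S obj (x', l', v')" and "optimal_value S obj = 0"
      then show "is_vGNE \<phi> X x'"
        using sufficient[of x' l' v'] by (simp add: is_minimizer_def zero_ereal_def)
    qed
  qed
qed

end
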